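(* Let $\xi,\eta$ be commuting variables, $j\in\{0,\tfrac12,1,\dots\}$ and $m\in\{-j,\dots,j\}$. Then the operators $$\tilde\Phi_{jm}(\xi,\eta)=\Phi_{jm}(\xi,\eta)\,e^{m\sigma},\qquad \sigma=-\ln\Bigl(1-2h\,\xi\frac{d}{d\eta}\Bigr),$$ are irreducible tensor operators for $\mathcal U_h(sl(2))$, i.e. $$\mathrm{ad}J_\pm(\tilde\Phi_{jm})=\sqrt{(j\mp m)(j\pm m+1)}\;\tilde\Phi_{j\,m\pm1},\qquad \mathrm{ad}J_0(\tilde\Phi_{jm})=2m\,\tilde\Phi_{jm}.$$
   Context: Here $\Phi_{jm}(\xi,\eta)=\dfrac{\xi^{j+m}\eta^{j-m}}{\sqrt{(j+m)!\,(j-m)!}}$ acts by multiplication on polynomials in $\xi,\eta$, and $sl(2)$ is realized by $$J_+=\xi\frac{d}{d\eta},\qquad J_-=\eta\frac{d}{d\xi},\qquad J_0=\xi\frac{d}{d\xi}-\eta\frac{d}{d\eta},$$ with $[J_0,J_\pm]=\pm2J_\pm$, $[J_+,J_-]=J_0$. The parameter is $h$, and functions of $\sigma=-\ln(1-2hJ_+)$ are understood as power series in $hJ_+$ ($J_+$ is locally nilpotent on polynomials). The Jordanian quantum algebra $\mathcal U_h(sl(2))$ has the same commutation relations and the Hopf algebra structure obtained from $\mathcal U(sl(2))$ by the Drinfeld twist $\mathcal F=\exp(-\tfrac12J_0\otimes\sigma)$: $\tilde\Delta=\mathcal F\Delta\mathcal F^{-1}$, $\tilde S=uSu^{-1}$,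 $u=m(\mathrm{id}\otimes S)(\mathcal F)$. The adjoint action on an operator $t$ is $\mathrm{ad}X(t)=\sum X_{(1)}\,t\,\tilde S(X_{(2)})$ where $\tilde\Delta(X)=\sum X_{(1)}\otimes X_{(2)}$; explicitly $$\mathrm{ad}J_0(t)=[J_0,t]e^{-\sigma},\qquad \mathrm{ad}J_+(t)=e^{-\sigma}[J_+e^{\sigma},t],$$ $$\mathrm{ad}J_-(t)=[J_-+hJ_0+\tfrac h2J_0^2,\,t]e^{-\sigma}-h[J_0,t]e^{-2\sigma}-\tfrac h2[J_0,[J_0,t]]e^{-2\sigma}.$$ Irreducible tensor operators are operators which form a basis of an irreducible representation under the adjoint action. *)

theory Defs
  imports Complex_Main
    "HOL-Computational_Algebra.Computational_Algebra"
    "HOL-Library.Function_Algebras"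
begin

text \<open>
  The polynomial ring \<open>\<complex>[\<xi>,\<eta>]\<close> is represented as \<open>\<complex>[\<eta>][\<xi>]\<close>: the outer variable is \<open>\<xi>\<close>, the
  inner one is \<open>\<eta>\<close>.
\<close>

type_synonym bipoly = "complex poly poly"
type_synonym operator = "bipoly \<Rightarrow> bipoly"

definition xi :: bipoly where "xi = [:0, 1:]"
definition eta :: bipoly where "eta = [:[:0, 1:]:]"

definition d_xi :: operator where "d_xi = pderiv"
definition d_eta :: operator where "d_eta = map_poly pderiv"

definition cscale :: "complex \<Rightarrow> bipoly \<Rightarrow> bipoly" where
  "cscale c p = smult [:c:] p"

definition op_scale :: "complex \<Rightarrow> operator \<Rightarrow> operator" where
  "op_scale c t = (\<lambda>p. cscale c (t p))"

interpretation bp: vector_space cscale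
proof unfold_locales
  fix a b :: complex and x y :: bipoly
  show "cscale (a + b) x = cscale a x + cscale b x"
    unfolding cscale_def smult_add_left[symmetric] by simp
  show "cscale 1 x = x"
    unfolding cscale_def pCons_one by simp
qed (auto simp: cscale_def smult_add_right mult.commute)

interpretation ops: vector_space op_scale
  by unfold_locales (auto simp: op_scale_def fun_eq_iff bp.scale_right_distrib bp.scale_left_distrib)

abbreviation linop :: "operator \<Rightarrow> bool" where
  "linop \<equiv> module_hom cscale cscale"

definition comm :: "operator \<Rightarrow> operator \<Rightarrow> operator" where
  "comm A B = (A \<circ> B) - (B \<circ> A)"

definition Jp :: operator where "Jp p = xi * d_eta p"
definition Jm :: operator where "Jm p = eta * d_xi p"
definition J0 :: operator where "J0 p = xi * d_xi p - eta * d_eta p"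

text \<open>
  The operator \<open>F(T)\<close> for a formal power series \<open>F\<close> and a locally nilpotent operator \<open>T\<close>; the sum is
  then finite for every \<open>p\<close>.
\<close>

definition op_series :: "complex fps \<Rightarrow> operator \<Rightarrow> operator" where
  "op_series F T p = (\<Sum>n | (T ^^ n) p \<noteq> 0. cscale (fps_nth F n) ((T ^^ n) p))"

text \<open>The series \<open>-ln (1 - 2X)\<close>; thus \<open>\<sigma>\<close> is its value at \<open>X = h J\<^sub>+\<close>.\<close>

definition sigma_fps :: "complex fps" where
  "sigma_fps = - fps_compose (fps_ln 1) (- fps_const 2 * fps_X)"

text \<open>The operator \<open>exp (c \<sigma>)\<close>.\<close>

definition exp_sigma :: "complex \<Rightarrow> complex \<Rightarrow> operator" where
  "exp_sigma h c = op_series (fps_compose (fps_exp c) sigma_fps) (op_scale h Jp)"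

text \<open>
  The image of \<open>S(\<sigma>)\<close>, where \<open>S\<close> is the antipode of \<open>\<U>(sl(2))\<close>: since \<open>S(J\<^sub>+) = -J\<^sub>+\<close>, it is
  \<open>-ln (1 + 2hJ\<^sub>+)\<close>.
\<close>

definition antipode_sigma :: "complex \<Rightarrow> operator" where
  "antipode_sigma h = op_series sigma_fps (op_scale (- h) Jp)"

text \<open>
  Elements of the (completed) algebra \<open>\<U>(sl(2)) \<otimes> \<U>(sl(2))\<close> enter only through the representation
  \<open>(a \<otimes> b) \<cdot> t = a t S(b)\<close> on operators \<open>t\<close>, in which products of tensors become compositions.
  In it the following two definitions are the image of
  \<open>exp (c J\<^sub>0 \<otimes> \<sigma>) = (\<Sum>n. c\<^sup>n/n! J\<^sub>0\<^sup>n \<otimes> \<sigma>\<^sup>n)\<close>, so that \<open>\<F>\<close> is the case \<open>c = -1/2\<close> and \<open>\<F>\<^sup>-\<^sup>1\<close> the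
  case \<open>c = 1/2\<close>, and the image of the undeformed coproduct \<open>\<Delta>(X) = X \<otimes> 1 + 1 \<otimes> X\<close> (with
  \<open>S(X) = -X\<close>) for \<open>X\<close> in \<open>sl(2)\<close>.
\<close>

definition twist_exp :: "complex \<Rightarrow> complex \<Rightarrow> operator \<Rightarrow> operator" where
  "twist_exp h c t p = (\<Sum>n | (antipode_sigma h ^^ n) p \<noteq> 0.
     cscale (c ^ n / fact n) ((J0 ^^ n) (t ((antipode_sigma h ^^ n) p))))"

definition primitive_coproduct :: "operator \<Rightarrow> operator \<Rightarrow> operator" where
  "primitive_coproduct X t = (X \<circ> t) - (t \<circ> X)"

definition twisted_coproduct :: "complex \<Rightarrow> operator \<Rightarrow> operator \<Rightarrow> operator" where
  "twisted_coproduct h X =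
     twist_exp h (- (1/2)) \<circ> primitive_coproduct X \<circ> twist_exp h (1/2)"

text \<open>\<open>u = m (id \<otimes> S) (\<F>)\<close> is \<open>\<F> \<cdot> id\<close>.\<close>

definition twist_u :: "complex \<Rightarrow> operator" where
  "twist_u h = twist_exp h (- (1/2)) id"

text \<open>
  \<open>ad X (t) = \<Sum> X\<^sub>(\<^sub>1\<^sub>) t u S(X\<^sub>(\<^sub>2\<^sub>)) u\<^sup>-\<^sup>1\<close> with Sweedler components taken from the twisted coproduct;
  to be used for \<open>X\<close> in the linear span of \<open>Jp\<close>, \<open>Jm\<close>, \<open>J0\<close>.
\<close>

definition ad :: "complex \<Rightarrow> operator \<Rightarrow> operator \<Rightarrow> operator" where
  "ad h X t = twisted_coproduct h X (t \<circ> twist_u h) \<circ> inv (twist_u h)"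

definition ad_stable :: "complex \<Rightarrow> operator set \<Rightarrow> bool" where
  "ad_stable h W \<longleftrightarrow> (\<forall>X\<in>{Jp, Jm, J0}. \<forall>t\<in>W. ad h X t \<in> W)"

text \<open>
  The relations of \<open>\<U>\<^sub>h(sl(2))\<close> as an algebra are those of \<open>\<U>(sl(2))\<close>.
\<close>

definition ad_representation :: "complex \<Rightarrow> operator set \<Rightarrow> bool" where
  "ad_representation h W \<longleftrightarrow>
     ops.subspace W \<and> ad_stable h W \<and>
     (\<forall>X\<in>{Jp, Jm, J0}. \<forall>s\<in>W. \<forall>t\<in>W. ad h X (s + t) = ad h X s + ad h X t) \<and>
     (\<forall>X\<in>{Jp, Jm, J0}. \<forall>c. \<forall>t\<in>W. ad h X (op_scale c t) = op_scale c (ad h X t)) \<and>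
     (\<forall>t\<in>W. ad h J0 (ad h Jp t) - ad h Jp (ad h J0 t) = op_scale 2 (ad h Jp t)) \<and>
     (\<forall>t\<in>W. ad h J0 (ad h Jm t) - ad h Jm (ad h J0 t) = op_scale (- 2) (ad h Jm t)) \<and>
     (\<forall>t\<in>W. ad h Jp (ad h Jm t) - ad h Jm (ad h Jp t) = ad h J0 t)"

definition ad_irreducible :: "complex \<Rightarrow> operator set \<Rightarrow> bool" where
  "ad_irreducible h W \<longleftrightarrow>
     ad_representation h W \<and> W \<noteq> {0} \<and>
     (\<forall>W'. ops.subspace W' \<and> W' \<subseteq> W \<and> ad_stable h W' \<longrightarrow> W' = {0} \<or> W' = W)"

definition irreducible_tensor_operators ::
    "complex \<Rightarrow> 'i set \<Rightarrow> ('i \<Rightarrow> operator) \<Rightarrow> bool" where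
  "irreducible_tensor_operators h I \<Theta> \<longleftrightarrow>
     inj_on \<Theta> I \<and> ops.independent (\<Theta> ` I) \<and> ad_irreducible h (ops.span (\<Theta> ` I))"

definition spins :: "real set" where
  "spins = {real n / 2 | n. True}"

definition weights :: "real \<Rightarrow> real set" where
  "weights j = {- j + real k | k. - j + real k \<le> j}"

text \<open>
  For \<open>m\<close> in \<open>weights j\<close> both \<open>j + m\<close> and \<open>j - m\<close> are natural numbers. Outside \<open>weights j\<close>
  the value of \<open>Phi\<close> is irrelevant: in the ladder relations it only occurs (at \<open>m = \<plusminus>(j + 1)\<close>) with
  coefficient \<open>0\<close>.
\<close>

definition Phi :: "real \<Rightarrow> real \<Rightarrow> bipoly" where
  "Phi j m =
     (let a = nat \<lfloor>j + m\<rfloor>; b = nat \<lfloor>j - m\<rfloor>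
      in cscale (complex_of_real (1 / sqrt (fact a * fact b))) (xi ^ a * eta ^ b))"

definition Phi_tilde :: "complex \<Rightarrow> real \<Rightarrow> real \<Rightarrow> operator" where
  "Phi_tilde h j m p = Phi j m * exp_sigma h (complex_of_real m) p"

text \<open>
  The rest of this theory checks that the adjoint action just defined has the expected explicit
  form (\<open>ad_J0_explicit\<close>, \<open>ad_Jp_explicit\<close>, \<open>ad_Jm_explicit\<close>), and that \<open>twist_u\<close> is
  invertible (\<open>bij_u\<close>).
\<close>

unbundle fps_syntax

text \<open>The coefficient of \<open>\<xi>\<^sup>a \<eta>\<^sup>b\<close>.\<close>

definition bcoeff :: "bipoly \<Rightarrow> nat \<Rightarrow> nat \<Rightarrow> complex" where "bcoeff p a b = coeff (coeff p a) b"

lemma cf_eqI: "(\<And>a b. bcoeff p a b = bcoeff q a b) \<Longrightarrow> p = q"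
  by (simp add: bcoeff_def poly_eq_iff)

lemma cf_add [simp]: "bcoeff (p + q) a b = bcoeff p a b + bcoeff q a b"
  and cf_diff [simp]: "bcoeff (p - q) a b = bcoeff p a b - bcoeff q a b"
  and cf_uminus [simp]: "bcoeff (- p) a b = - bcoeff p a b"
  and cf_scale [simp]: "bcoeff (cscale c p) a b = c * bcoeff p a b"
  and cf_0 [simp]: "bcoeff 0 a b = 0"
  by (auto simp: bcoeff_def cscale_def)

lemma cf_2: "bcoeff (2 * p) a b = 2 * bcoeff p a b"
  by (simp only: mult_2 cf_add)

lemma cf_sum: "bcoeff (sum f A) a b = (\<Sum>x\<in>A. bcoeff (f x) a b)"
  by (simp add: bcoeff_def coeff_sum)

lemma cf_xi: "bcoeff (xi * p) a b = (if a = 0 then 0 else bcoeff p (a - 1) b)"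
  by (simp add: bcoeff_def xi_def coeff_pCons split: nat.splits)

lemma cf_eta: "bcoeff (eta * p) a b = (if b = 0 then 0 else bcoeff p a (b - 1))"
  by (simp add: bcoeff_def eta_def coeff_pCons split: nat.splits)

lemma cf_d_xi: "bcoeff (d_xi p) a b = of_nat (Suc a) * bcoeff p (Suc a) b"
  by (simp add: bcoeff_def d_xi_def coeff_pderiv of_nat_poly)

lemma cf_d_eta: "bcoeff (d_eta p) a b = of_nat (Suc b) * bcoeff p a (Suc b)"
  by (simp add: bcoeff_def d_eta_def coeff_map_poly coeff_pderiv)

lemma cf_Jp: "bcoeff (Jp p) a b = (if a = 0 then 0 else of_nat (Suc b) * bcoeff p (a - 1) (Suc b))"
  by (simp add: Jp_def cf_xi cf_d_eta)

lemma cf_Jm: "bcoeff (Jm p) a b = (if b = 0 then 0 else of_nat (Suc a) * bcoeff p (Suc a) (b - 1))"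
  by (simp add: Jm_def cf_eta cf_d_xi)

lemma cf_J0: "bcoeff (J0 p) a b = (of_nat a - of_nat b) * bcoeff p a b"
  by (cases a; cases b) (simp_all add: J0_def cf_xi cf_eta cf_d_xi cf_d_eta algebra_simps)

lemma cf_J0_pow: "bcoeff ((J0 ^^ n) p) a b = (of_nat a - of_nat b) ^ n * bcoeff p a b"
  by (induction n) (simp_all add: cf_J0)

lemma linopI: "\<lbrakk>\<And>p q. t (p + q) = t p + t q; \<And>c p. t (cscale c p) = cscale c (t p)\<rbrakk> \<Longrightarrow> linop t"
  by unfold_locales auto

lemmas linops = module_hom.add[where ?s1.0=cscale and ?s2.0=cscale]
  module_hom.diff[where ?s1.0=cscale and ?s2.0=cscale]
  module_hom.neg[where ?s1.0=cscale and ?s2.0=cscale]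
  module_hom.zero[where ?s1.0=cscale and ?s2.0=cscale]
  module_hom.scale[where ?s1.0=cscale and ?s2.0=cscale]
  module_hom.sum[where ?s1.0=cscale and ?s2.0=cscale]

lemma linop_J: "linop Jp" "linop Jm" "linop J0"
  by (auto intro!: linopI cf_eqI simp: cf_Jp cf_Jm cf_J0 algebra_simps)

lemma linop_op_scale: "linop t \<Longrightarrow> linop (op_scale c t)"
  by (rule linopI) (simp_all add: op_scale_def linops
     bp.scale_right_distrib mult.commute)

lemma Jp_nilpotent: "\<exists>N. (Jp ^^ N) p = 0"
proof -
  have cfN: "bcoeff ((Jp ^^ n) p) a b = 0" if "\<And>a b. b \<ge> N \<Longrightarrow> bcoeff p a b = 0" "b + n \<ge> N" for n N a b
    using that(2)
  proof (induction n arbitrary: a b)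
    case (Suc n)
    show ?case using Suc.prems by (simp add: cf_Jp Suc.IH)
  qed (use that in auto)
  define N where "N = Suc (Max ((\<lambda>a. degree (coeff p a)) ` {..degree p}))"
  have "bcoeff p a b = 0" if "b \<ge> N" for a b
  proof (cases "a \<le> degree p")
    case True
    then have "degree (coeff p a) \<le> Max ((\<lambda>a. degree (coeff p a)) ` {..degree p})"
      by (intro Max_ge) auto
    with that show ?thesis by (simp add: bcoeff_def coeff_eq_0 N_def)
  qed (simp add: bcoeff_def coeff_eq_0)
  then have "(Jp ^^ N) p = 0" by (intro cf_eqI) (simp add: cfN[of N])
  then show ?thesis by blast
qed

subsection \<open>Power series in \<open>h J\<^sub>+\<close>\<close>

lemma linop_pow: "linop t \<Longrightarrow> linop (t ^^ n)"
  by (induction n) (auto intro!: linopI simp: linops)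

lemma op_scale_pow: "linop t \<Longrightarrow> (op_scale c t ^^ n) p = cscale (c ^ n) ((t ^^ n) p)"
  by (induction n) (auto simp: op_scale_def linops)

context
  fixes h :: complex
begin

definition "hJp = op_scale h Jp"
abbreviation "srs F \<equiv> op_series F hJp"

lemma linop_T: "linop hJp" by (simp add: hJp_def linop_op_scale linop_J)

lemma T_nilpotent: "\<exists>N. (hJp ^^ N) p = 0"
  using Jp_nilpotent[of p] by (auto simp: hJp_def op_scale_pow linop_J)

lemma nil_mono: "linop t \<Longrightarrow> (t ^^ N) p = 0 \<Longrightarrow> N \<le> n \<Longrightarrow> (t ^^ n) p = 0"
  using funpow_add[of "n - N" N t] by (simp add: linops linop_pow)

lemma op_series_eq:
  assumes "linop t" "(t ^^ N) p = 0"
  shows "op_series F t p = (\<Sum>n<N. cscale (F $ n) ((t ^^ n) p))"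
  unfolding op_series_def using nil_mono[OF assms]
  by (intro sum.mono_neutral_left) (auto simp: not_less[symmetric])

lemma linop_S: "linop (srs F)"
proof (rule linopI)
  fix p q
  obtain N1 N2 where "(hJp ^^ N1) p = 0" "(hJp ^^ N2) q = 0" using T_nilpotent by meson
  then have *: "(hJp ^^ (max N1 N2)) p = 0" "(hJp ^^ (max N1 N2)) q = 0"
    by (auto intro: nil_mono linop_T)
  then have pq: "(hJp ^^ (max N1 N2)) (p + q) = 0"
    by (simp add: linops linop_pow linop_T)
  show "srs F (p + q) = srs F p + srs F q"
    by (simp add: op_series_eq[OF linop_T *(1)] op_series_eq[OF linop_T *(2)]
        op_series_eq[OF linop_T pq] linops(1) linop_pow linop_T
        bp.scale_right_distrib sum.distrib)
next
  fix c p
  obtain N where *: "(hJp ^^ N) p = 0" using T_nilpotent by meson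
  then have cp: "(hJp ^^ N) (cscale c p) = 0" by (simp add: linops linop_pow linop_T)
  show "srs F (cscale c p) = cscale c (srs F p)"
    by (simp add: op_series_eq[OF linop_T *] op_series_eq[OF linop_T cp] linops(5) linop_pow linop_T
        bp.scale_sum_right mult.commute)
qed

lemmas lin_rules = linops

lemma S_add: "srs (F + G) p = srs F p + srs G p"
  and S_const_mult: "srs (fps_const c * F) p = cscale c (srs F p)"
  and S_const: "srs (fps_const c) p = cscale c p"
  and S_X: "srs fps_X p = hJp p"
proof -
  obtain N where *: "(hJp ^^ N) p = 0" using T_nilpotent by meson
  have N: "(hJp ^^ Suc (Suc N)) p = 0"
    by (rule nil_mono[OF linop_T *]) simp
  show "srs (F + G) p = srs F p + srs G p" "srs (fps_const c * F) p = cscale c (srs F p)"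
    by (simp_all add: op_series_eq[OF linop_T *] bp.scale_left_distrib sum.distrib bp.scale_sum_right)
  have "srs (fps_const c) p = (\<Sum>n\<in>{0}. cscale (fps_const c $ n) ((hJp ^^ n) p))"
    unfolding op_series_eq[OF linop_T N] by (intro sum.mono_neutral_right) auto
  then show "srs (fps_const c) p = cscale c p" by simp
  have "srs fps_X p = (\<Sum>n\<in>{1}. cscale (fps_X $ n :: complex) ((hJp ^^ n) p))"
    unfolding op_series_eq[OF linop_T N] by (intro sum.mono_neutral_right) auto
  then show "srs fps_X p = hJp p" by simp
qed

lemma S_1: "srs 1 p = p" using S_const[of 1 p] by simp
lemma S_0: "srs 0 p = 0" using S_const[of 0 p] by simp
lemma S_uminus: "srs (- F) p = - srs F p"
  using S_add[of F "- F" p] by (simp add: S_0 eq_neg_iff_add_eq_0 add.commute)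
lemma S_diff: "srs (F - G) p = srs F p - srs G p"
  using S_add[of F "- G" p] by (simp add: S_uminus)

lemma S_mult: "srs (F * G) p = srs F (srs G p)"
proof -
  obtain N where *: "(hJp ^^ N) p = 0" using T_nilpotent by meson
  have z: "(hJp ^^ k) p = 0" if "k \<ge> N" for k using nil_mono[OF linop_T * that] .
  have zG: "(hJp ^^ N) (srs G p) = 0"
  proof -
    have "(hJp ^^ N) (srs G p) = (\<Sum>n<N. cscale (G $ n) ((hJp ^^ (N + n)) p))"
      by (simp add: op_series_eq[OF linop_T *] lin_rules[OF linop_pow[OF linop_T]] funpow_add)
    also have "\<dots> = 0" by (intro sum.neutral) (simp add: z)
    finally show ?thesis .
  qed
  have "srs F (srs G p) = (\<Sum>i<N. \<Sum>k<N. cscale (F $ i * G $ k) ((hJp ^^ (i + k)) p))"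
    by (simp add: op_series_eq[OF linop_T zG])
       (simp add: op_series_eq[OF linop_T *] lin_rules[OF linop_pow[OF linop_T]] funpow_add
        bp.scale_sum_right)
  also have "\<dots> = (\<Sum>(i,k)\<in>{..<N} \<times> {..<N}. cscale (F $ i * G $ k) ((hJp ^^ (i + k)) p))"
    by (simp add: sum.cartesian_product)
  also have "\<dots> = (\<Sum>(i,k)\<in>{(i,k). i + k < N}. cscale (F $ i * G $ k) ((hJp ^^ (i + k)) p))"
  proof (intro sum.mono_neutral_right ballI)
    fix x assume "x \<in> {..<N} \<times> {..<N} - {(i, k). i + k < N}"
    then show "(case x of (i, k) \<Rightarrow> cscale (F $ i * G $ k) ((hJp ^^ (i + k)) p)) = 0"
      using z[of "fst x + snd x"] by (cases x) auto
  qed auto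
  also have "\<dots> = (\<Sum>n<N. \<Sum>i\<le>n. cscale (F $ i * G $ (n - i)) ((hJp ^^ n) p))"
    by (simp add: sum.triangle_reindex)
  also have "\<dots> = srs (F * G) p"
    by (simp add: op_series_eq[OF linop_T *] fps_mult_nth bp.scale_sum_left atMost_atLeast0)
  finally show ?thesis by simp
qed


lemma S_power: "(srs F ^^ n) p = srs (F ^ n) p"
  by (induction n) (simp_all add: S_1 S_mult)

lemma S_comm: "srs F (srs G p) = srs G (srs F p)"
  by (simp add: S_mult[symmetric] mult.commute)

lemma S_zero_high:
  assumes "(hJp ^^ N) p = 0" "\<And>k. k < N \<Longrightarrow> F $ k = 0"
  shows "srs F p = 0"
  using assms(2) by (simp add: op_series_eq[OF linop_T assms(1)])

lemma S_compose:
  assumes "G $ 0 = 0"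
  shows "op_series F (srs G) p = srs (fps_compose F G) p"
proof -
  obtain N where *: "(hJp ^^ N) p = 0" using T_nilpotent by meson
  have low: "(G ^ n) $ k = 0" if "k < n" for n k
    using startsby_zero_power_prefix[OF assms] that by auto
  have N: "(srs G ^^ N) p = 0"
    unfolding S_power by (rule S_zero_high[OF *]) (rule low)
  have "op_series F (srs G) p = (\<Sum>n<N. \<Sum>k<N. cscale (F $ n * (G ^ n) $ k) ((hJp ^^ k) p))"
    by (simp add: op_series_eq[OF linop_S N] S_power op_series_eq[OF linop_T *] bp.scale_sum_right)
  also have "\<dots> = (\<Sum>k<N. \<Sum>n<N. cscale (F $ n * (G ^ n) $ k) ((hJp ^^ k) p))"
    by (rule sum.swap)
  also have "\<dots> = (\<Sum>k<N. \<Sum>n=0..k. cscale (F $ n * (G ^ n) $ k) ((hJp ^^ k) p))"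
    by (intro sum.cong refl sum.mono_neutral_right) (auto simp: low)
  also have "\<dots> = srs (fps_compose F G) p"
    by (simp add: op_series_eq[OF linop_T *] fps_compose_nth bp.scale_sum_left)
  finally show ?thesis .
qed

lemma op_series_scaled: "op_series F (op_scale (- h) Jp) = srs (fps_compose F (- fps_X))"
proof -
  have "op_scale (- h) Jp = srs (- fps_X)"
    by (rule ext) (simp only: S_uminus S_X, simp add: hJp_def op_scale_def)
  show ?thesis unfolding \<open>op_scale (- h) Jp = _\<close>
    by (rule ext, rule S_compose) simp
qed

lemma T_nilpotent3: "\<exists>N. (hJp ^^ N) p = 0 \<and> (hJp ^^ N) q = 0 \<and> (hJp ^^ N) r = 0"
proof -
  obtain N1 N2 N3 where N: "(hJp ^^ N1) p = 0" "(hJp ^^ N2) q = 0" "(hJp ^^ N3) r = 0"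
    using T_nilpotent by meson
  then have "(hJp ^^ max N1 (max N2 N3)) p = 0 \<and> (hJp ^^ max N1 (max N2 N3)) q = 0 \<and> (hJp ^^ max N1 (max N2 N3)) r = 0"
    using nil_mono[OF linop_T N(1)] nil_mono[OF linop_T N(2)] nil_mono[OF linop_T N(3)] by auto
  then show ?thesis by blast
qed

lemma J0_T: "J0 (hJp p) = hJp (J0 p) + cscale 2 (hJp p)"
  by (rule cf_eqI) (auto simp: hJp_def op_scale_def cf_J0 cf_Jp algebra_simps of_nat_diff)

lemma T_Jm: "hJp (Jm p) = Jm (hJp p) + cscale h (J0 p)"
  by (rule cf_eqI) (auto simp: hJp_def op_scale_def cf_J0 cf_Jp cf_Jm algebra_simps of_nat_diff)

lemma J0_T_pow: "J0 ((hJp ^^ n) p) = (hJp ^^ n) (J0 p) + cscale (2 * of_nat n) ((hJp ^^ n) p)"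
proof (induction n)
  case (Suc n)
  then show ?case
    by (simp add: J0_T linops(1,5) linop_T bp.scale_left_distrib[symmetric] add.assoc)
qed simp

lemma T_pow_Jm: "(hJp ^^ n) (Jm p) = Jm ((hJp ^^ n) p)
   + cscale (h * of_nat n) ((hJp ^^ (n - 1)) (J0 p))
   + cscale (h * of_nat n * of_nat (n - 1)) ((hJp ^^ (n - 1)) p)"
proof (induction n)
  case (Suc n)
  show ?case
  proof (cases n)
    case (Suc k)
    have e: "(hJp ^^ Suc n) (Jm p) = hJp (Jm ((hJp ^^ n) p))
       + cscale (h * of_nat n) ((hJp ^^ n) (J0 p))
       + cscale (h * of_nat n * of_nat k) ((hJp ^^ n) p)"
      using Suc.IH by (simp add: Suc linops(1,5) linop_T)
    have e2: "hJp (Jm ((hJp ^^ n) p)) = Jm ((hJp ^^ Suc n) p) + cscale h ((hJp ^^ n) (J0 p))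
        + cscale (2 * h * of_nat n) ((hJp ^^ n) p)"
      by (simp add: T_Jm J0_T_pow bp.scale_right_distrib mult.commute)
    show ?thesis unfolding e e2 by (intro cf_eqI) (simp add: Suc cf_2 algebra_simps)
  qed (simp add: T_Jm)
qed simp

lemma J0_S: "J0 (srs F p) = srs F (J0 p) + cscale 2 (srs (fps_X * fps_deriv F) p)"
proof -
  obtain N where N: "(hJp ^^ N) p = 0" "(hJp ^^ N) (J0 p) = 0" using T_nilpotent3 by meson
  have X: "(fps_X * fps_deriv F) $ n = of_nat n * F $ n" for n
    by (cases n) auto
  show ?thesis
    unfolding op_series_eq[OF linop_T N(1)] op_series_eq[OF linop_T N(2)] X
    by (simp add: linops linop_J J0_T_pow
        bp.scale_right_distrib sum.distrib bp.scale_sum_right algebra_simps)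
qed

lemma S_Jm: "srs F (Jm p) = Jm (srs F p) + cscale h (srs (fps_deriv F) (J0 p))
   + cscale h (srs (fps_X * fps_deriv (fps_deriv F)) p)"
proof -
  obtain N where N: "(hJp ^^ N) p = 0" "(hJp ^^ N) (J0 p) = 0" "(hJp ^^ N) (Jm p) = 0"
    using T_nilpotent3 by meson
  have N': "(hJp ^^ Suc N) p = 0" "(hJp ^^ Suc N) (Jm p) = 0"
    using nil_mono[OF linop_T N(1), of "Suc N"] nil_mono[OF linop_T N(3), of "Suc N"] by auto
  have X: "(fps_X * fps_deriv (fps_deriv F)) $ n = of_nat n * of_nat (Suc n) * F $ Suc n" for n
    by (cases n) (auto simp: algebra_simps)
  have "srs F (Jm p) = Jm (srs F p) + (\<Sum>n<Suc N. cscale (F $ n) (cscale (h * of_nat n) ((hJp ^^ (n - 1)) (J0 p))))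
     + (\<Sum>n<Suc N. cscale (F $ n) (cscale (h * of_nat n * of_nat (n - 1)) ((hJp ^^ (n - 1)) p)))"
    by (simp only: op_series_eq[OF linop_T N'(1)] op_series_eq[OF linop_T N'(2)] linops[OF linop_J(2)] T_pow_Jm
        bp.scale_right_distrib sum.distrib)
  also have "(\<Sum>n<Suc N. cscale (F $ n) (cscale (h * of_nat n) ((hJp ^^ (n - 1)) (J0 p))))
      = cscale h (srs (fps_deriv F) (J0 p))"
    unfolding sum.lessThan_Suc_shift op_series_eq[OF linop_T N(2)]
    by (simp add: bp.scale_sum_right algebra_simps)
  also have "(\<Sum>n<Suc N. cscale (F $ n) (cscale (h * of_nat n * of_nat (n - 1)) ((hJp ^^ (n - 1)) p)))
      = cscale h (srs (fps_X * fps_deriv (fps_deriv F)) p)"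
    unfolding sum.lessThan_Suc_shift op_series_eq[OF linop_T N(1)] X
    by (simp add: bp.scale_sum_right algebra_simps)
  finally show ?thesis .
qed

subsection \<open>The twist\<close>

text \<open>
  As power series in \<open>h J\<^sub>+\<close>: \<open>S(\<sigma>)\<close>, \<open>exp (x S(\<sigma>))\<close> and \<open>exp (x \<sigma>)\<close>.
\<close>

definition "tau_fps = fps_compose sigma_fps (- fps_X)"
definition "etau_fps x = fps_compose (fps_exp x) tau_fps"
definition "esig_fps x = fps_compose (fps_exp x) sigma_fps"

lemma exp_sigma_S: "exp_sigma h x = srs (esig_fps x)"
  by (simp add: exp_sigma_def esig_fps_def hJp_def)

lemma antipode_sigma_S: "antipode_sigma h = srs tau_fps"
  by (simp only: antipode_sigma_def tau_fps_def op_series_scaled)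

lemma sigma_0 [simp]: "sigma_fps $ 0 = 0" by (simp add: sigma_fps_def)
lemma tau_0 [simp]: "tau_fps $ 0 = 0" by (simp add: tau_fps_def)

abbreviation wgt :: "nat \<Rightarrow> nat \<Rightarrow> complex" where "wgt a b \<equiv> of_nat a - of_nat b"

lemma cf_twist:
  assumes "linop t"
  shows "bcoeff (twist_exp h c t p) a b = bcoeff (t (srs (etau_fps (c * wgt a b)) p)) a b"
proof -
  obtain N where *: "(hJp ^^ N) p = 0" using T_nilpotent by meson
  have N: "(srs tau_fps ^^ N) p = 0"
    unfolding S_power using startsby_zero_power_prefix[OF tau_0] by (intro S_zero_high[OF *]) auto
  have "twist_exp h c t p = (\<Sum>n<N. cscale (c ^ n / fact n) ((J0 ^^ n) (t ((srs tau_fps ^^ n) p))))"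
    unfolding twist_exp_def antipode_sigma_S using nil_mono[OF linop_S N]
    by (intro sum.mono_neutral_left)
       (auto simp: linops[OF assms] linops[OF linop_pow[OF linop_J(3)]] not_less[symmetric])
  then have "bcoeff (twist_exp h c t p) a b
     = bcoeff (t (\<Sum>n<N. cscale (fps_exp (c * wgt a b) $ n) ((srs tau_fps ^^ n) p))) a b"
    by (simp add: linops[OF assms] cf_sum cf_J0_pow power_mult_distrib mult.assoc)
  also have "(\<Sum>n<N. cscale (fps_exp (c * wgt a b) $ n) ((srs tau_fps ^^ n) p)) = srs (etau_fps (c * wgt a b)) p"
    by (simp add: etau_fps_def S_compose[OF tau_0, symmetric] op_series_eq[OF linop_S N])
  finally show ?thesis .
qed

lemma Et_add: "etau_fps (x + y) = etau_fps x * etau_fps y"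
  by (simp add: etau_fps_def fps_exp_add_mult fps_compose_mult_distrib)
lemma E_add: "esig_fps (x + y) = esig_fps x * esig_fps y"
  by (simp add: esig_fps_def fps_exp_add_mult fps_compose_mult_distrib)
lemma Et_0 [simp]: "etau_fps 0 = 1" by (simp add: etau_fps_def)
lemma E_0 [simp]: "esig_fps 0 = 1" by (simp add: esig_fps_def)

lemma linop_twist: "linop t \<Longrightarrow> linop (twist_exp h c t)"
  by (rule linopI; rule cf_eqI) (simp_all add: cf_twist linops linop_S)

lemma twist_add: "linop t \<Longrightarrow> twist_exp h c (twist_exp h d t) = twist_exp h (c + d) t"
  by (rule ext, rule cf_eqI)
     (simp add: cf_twist linop_twist distrib_right Et_add S_mult[symmetric] mult.commute)

lemma twist_0: "linop t \<Longrightarrow> twist_exp h 0 t = t"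
  by (rule ext, rule cf_eqI) (simp add: cf_twist S_1)


lemma cf_T: "bcoeff (hJp p) a b = (if a = 0 then 0 else h * of_nat (Suc b) * bcoeff p (a - 1) (Suc b))"
  by (simp add: hJp_def op_scale_def cf_Jp)

subsection \<open>Series identities\<close>

lemma sigma_deriv': "fps_deriv sigma_fps = fps_const 2 * inverse (1 - fps_const 2 * fps_X)"
proof -
  have "1 - fps_const 2 * fps_X = (1 + - fps_const 2 * fps_X :: complex fps)" by simp
  then show ?thesis unfolding sigma_fps_def
    by (simp only:) (simp add: fps_compose_deriv fps_ln_deriv fps_inverse_compose fps_compose_add_distrib
       fps_const_neg[symmetric] del: fps_const_neg)
qed

lemma E_m1: "esig_fps (- 1) = 1 - fps_const 2 * fps_X"
proof -
  let ?Q = "1 - fps_const 2 * fps_X :: complex fps"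
  have Q: "inverse ?Q * ?Q = 1" by (rule inverse_mult_eq_1) simp
  have d: "fps_deriv (esig_fps (- 1)) = - (fps_const 2 * inverse ?Q * esig_fps (- 1))"
    by (simp add: esig_fps_def fps_compose_deriv sigma_deriv' fps_compose_uminus fps_compose_mult_distrib fps_const_neg[symmetric] mult_ac del: fps_const_neg)
  have di: "fps_deriv (inverse ?Q) = fps_const 2 * inverse ?Q * inverse ?Q"
    by (simp add: fps_inverse_deriv power2_eq_square)
  have "fps_deriv (esig_fps (- 1) * inverse ?Q) = 0"
    by (simp add: d di)
  then have "esig_fps (- 1) * inverse ?Q = fps_const ((esig_fps (- 1) * inverse ?Q) $ 0)"
    by (simp only: fps_deriv_eq_0_iff)
  also have "(esig_fps (- 1) * inverse ?Q) $ 0 = 1" by (simp add: esig_fps_def)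
  finally have "esig_fps (- 1) * inverse ?Q * ?Q = ?Q" by simp
  then show ?thesis by (simp add: mult.assoc Q)
qed

lemma E_inv: "esig_fps x * esig_fps (- x) = 1" by (simp add: E_add[symmetric])
lemma Et_inv: "etau_fps x * etau_fps (- x) = 1" by (simp add: Et_add[symmetric])

lemma sigma_deriv: "fps_deriv sigma_fps = fps_const 2 * esig_fps 1"
proof -
  have "esig_fps 1 = inverse (esig_fps (- 1))"
    using E_inv[of 1] by (metis fps_inverse_unique mult.commute)
  then show ?thesis by (simp add: sigma_deriv' E_m1)
qed

lemma Et_E: "etau_fps x = fps_compose (esig_fps x) (- fps_X)"
  unfolding etau_fps_def esig_fps_def tau_fps_def by (rule fps_compose_assoc) simp_all

lemma Et_m1: "etau_fps (- 1) = 1 + fps_const 2 * fps_X"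
  by (simp add: Et_E E_m1 fps_compose_sub_distrib fps_compose_mult_distrib)

lemma tau_deriv: "fps_deriv tau_fps = - (fps_const 2 * etau_fps 1)"
  by (simp add: tau_fps_def Et_E fps_compose_deriv sigma_deriv fps_compose_mult_distrib)

lemma E_deriv: "fps_deriv (esig_fps x) = fps_const (2 * x) * esig_fps (x + 1)"
proof -
  have "fps_deriv (esig_fps x) = fps_const x * esig_fps x * (fps_const 2 * esig_fps 1)"
    by (simp add: esig_fps_def[of x] fps_compose_deriv sigma_deriv fps_compose_mult_distrib)
  then show ?thesis by (simp add: E_add fps_const_mult[symmetric] del: fps_const_mult)
qed

lemma Et_deriv: "fps_deriv (etau_fps x) = fps_const (- 2 * x) * etau_fps (x + 1)"
proof -
  have "fps_deriv (etau_fps x) = fps_const x * etau_fps x * - (fps_const 2 * etau_fps 1)"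
    by (simp add: etau_fps_def[of x] fps_compose_deriv tau_deriv fps_compose_mult_distrib)
  also have "\<dots> = fps_const (- 2 * x) * (etau_fps x * etau_fps 1)"
    by (simp add: fps_const_mult[symmetric] fps_const_neg[symmetric] del: fps_const_mult fps_const_neg)
  finally show ?thesis by (simp add: Et_add)
qed

lemma X_E: "fps_const 2 * (fps_X * esig_fps (x + 1)) = esig_fps (x + 1) - esig_fps x"
proof -
  have "esig_fps x = esig_fps (- 1) * esig_fps (x + 1)" by (simp add: E_add[symmetric])
  then show ?thesis by (simp add: E_m1 algebra_simps)
qed

lemma X_Et: "fps_const 2 * (fps_X * etau_fps (x + 1)) = etau_fps x - etau_fps (x + 1)"
proof -
  have "etau_fps x = etau_fps (- 1) * etau_fps (x + 1)" by (simp add: Et_add[symmetric])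
  then show ?thesis by (simp add: Et_m1 algebra_simps)
qed

lemma X_E_deriv: "fps_X * fps_deriv (esig_fps x) = fps_const x * (esig_fps (x + 1) - esig_fps x)"
  unfolding E_deriv X_E[symmetric] by (simp add: fps_const_mult[symmetric] del: fps_const_mult)

lemma X_Et_deriv: "fps_X * fps_deriv (etau_fps x) = fps_const (- x) * (etau_fps x - etau_fps (x + 1))"
  unfolding Et_deriv X_Et[symmetric]
  by (simp add: fps_const_mult[symmetric] fps_const_neg[symmetric] del: fps_const_mult fps_const_neg)

lemma Et_deriv2: "fps_X * fps_deriv (fps_deriv (etau_fps x))
    = fps_const (2 * x * (x + 1)) * (etau_fps (x + 1) - etau_fps (x + 2))"
proof -
  have "fps_X * fps_deriv (fps_deriv (etau_fps x)) = fps_const (- 2 * x) * (fps_X * fps_deriv (etau_fps (x + 1)))"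
    by (simp add: Et_deriv[of x])
  also have "\<dots> = fps_const (- 2 * x) * (fps_const (- (x + 1)) * (etau_fps (x + 1) - etau_fps (x + 2)))"
    by (simp only: X_Et_deriv) (simp add: add.assoc)
  also have "\<dots> = fps_const (2 * x * (x + 1)) * (etau_fps (x + 1) - etau_fps (x + 2))"
    by (simp add: mult.assoc[symmetric]) (simp add: algebra_simps)
  finally show ?thesis .
qed

lemma J0_E: "J0 (srs (esig_fps x) p) = srs (esig_fps x) (J0 p) + cscale (2 * x) (srs (esig_fps (x + 1)) p - srs (esig_fps x) p)"
  unfolding J0_S X_E_deriv S_const_mult S_diff by simp

lemma J0_Et: "J0 (srs (etau_fps x) p) = srs (etau_fps x) (J0 p) - cscale (2 * x) (srs (etau_fps x) p - srs (etau_fps (x + 1)) p)"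
  unfolding J0_S X_Et_deriv S_const_mult S_diff by simp

lemma Jm_Et: "Jm (srs (etau_fps x) p) = srs (etau_fps x) (Jm p) + cscale (2 * h * x) (srs (etau_fps (x + 1)) (J0 p))
   - cscale (2 * h * x * (x + 1)) (srs (etau_fps (x + 1)) p - srs (etau_fps (x + 2)) p)"
  using S_Jm[of "etau_fps x" p] unfolding Et_deriv2
  by (simp add: Et_deriv S_const_mult S_diff mult.assoc mult.left_commute[of h] S_uminus)

subsection \<open>Commuting the generators through the twist\<close>

abbreviation "twm \<equiv> twist_exp h (- (1/2))"
abbreviation "twu \<equiv> twist_u h"

lemma linop_comp: "linop s \<Longrightarrow> linop t \<Longrightarrow> linop (s \<circ> t)"
  by (rule linopI) (simp_all add: linops)
lemma linop_id: "linop id" by (rule linopI) auto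
lemma linop_minus: "linop s \<Longrightarrow> linop t \<Longrightarrow> linop (s - t)"
  by (rule linopI) (simp_all add: linops algebra_simps bp.scale_right_diff_distrib)
lemma linop_u: "linop twu" by (simp add: twist_u_def linop_twist linop_id)

lemmas linI = linop_comp linop_id linop_minus linop_u linop_J linop_T linop_S linop_twist

lemma tw_diff: "linop s \<Longrightarrow> linop t \<Longrightarrow> twm (s - t) = twm s - twm t"
  by (rule ext, rule cf_eqI) (simp add: cf_twist linI)

lemma tw_J0_left: "linop s \<Longrightarrow> twm (J0 \<circ> s) p = J0 (twm s p)"
  by (rule cf_eqI) (simp add: cf_twist linI cf_J0)

lemma tw_Jp_left:
  assumes s: "linop s"
  shows "twm (Jp \<circ> s) p = Jp (twm s (srs (etau_fps (- 1)) p))"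
proof (rule cf_eqI)
  fix a b
  show "bcoeff (twm (Jp \<circ> s) p) a b = bcoeff (Jp (twm s (srs (etau_fps (- 1)) p))) a b"
  proof (cases a)
    case (Suc a')
    define x where "x = - (1/2) * wgt (Suc a') b"
    have x: "- (1/2) * wgt a' (Suc b) = x + 1" by (simp add: x_def field_simps)
    show ?thesis unfolding Suc cf_Jp
      by (simp add: cf_twist[OF s] cf_twist[OF linop_comp[OF linop_J(1) s]] x[simplified]
          S_mult[symmetric] Et_add[symmetric] cf_Jp x_def[simplified, symmetric])
  qed (simp add: cf_twist linI s cf_Jp)
qed

lemma Jp_S: "Jp (srs F p) = srs F (Jp p)"
proof -
  have pow: "Jp ((hJp ^^ n) p) = (hJp ^^ n) (Jp p)" for n p
    by (induction n) (simp_all add: hJp_def op_scale_def linops[OF linop_J(1)])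
  obtain N where N: "(hJp ^^ N) p = 0" "(hJp ^^ N) (Jp p) = 0" using T_nilpotent3 by meson
  show ?thesis
    by (simp add: op_series_eq[OF linop_T N(1)] op_series_eq[OF linop_T N(2)] pow linops[OF linop_J(1)])
qed

lemma tw_Jp_right: "linop s \<Longrightarrow> twm (s \<circ> Jp) p = twm s (Jp p)"
  by (rule cf_eqI) (simp add: cf_twist linI Jp_S)

lemma tw_Jm_left:
  assumes s: "linop s"
  shows "twm (Jm \<circ> s) p = Jm (twm s (srs (etau_fps 1) p))"
proof (rule cf_eqI)
  fix a b
  show "bcoeff (twm (Jm \<circ> s) p) a b = bcoeff (Jm (twm s (srs (etau_fps 1) p))) a b"
  proof (cases b)
    case (Suc b')
    define x where "x = - (1/2) * wgt a (Suc b')"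
    have x: "- (1/2) * wgt (Suc a) b' = x - 1" by (simp add: x_def field_simps)
    show ?thesis unfolding Suc cf_Jm
      by (simp add: cf_twist[OF s] cf_twist[OF linop_comp[OF linop_J(2) s]] x[simplified]
          S_mult[symmetric] Et_add[symmetric] cf_Jm x_def[simplified, symmetric])
  qed (simp add: cf_twist linI s cf_Jm)
qed

lemma tw_J0_right:
  assumes s: "linop s"
  shows "twm (s \<circ> J0) p = twm s (J0 p) + J0 (twm s (p - srs (etau_fps 1) p))"
proof (rule cf_eqI)
  fix a b
  define x where "x = - (1/2) * wgt a b"
  have w: "wgt a b = - 2 * x" by (simp add: x_def field_simps)
  have twm: "bcoeff (twm t q) a b = bcoeff (t (srs (etau_fps x) q)) a b" if "linop t" for t q
    using cf_twist[OF that] by (simp add: x_def)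
  show "bcoeff (twm (s \<circ> J0) p) a b = bcoeff (twm s (J0 p) + J0 (twm s (p - srs (etau_fps 1) p))) a b"
    unfolding cf_add cf_J0 w twm[OF s] twm[OF linop_comp[OF s linop_J(3)]] o_apply J0_Et
    by (simp add: linops[OF s] linops[OF linop_S] Et_add S_mult S_comm[of "etau_fps x" "etau_fps 1"] S_comm[of "etau_fps x" "etau_fps 2"] algebra_simps)
qed

lemma tw_Jm_right:
  assumes s: "linop s"
  shows "twm (s \<circ> Jm) p = twm s (Jm p) - cscale h (J0 (twm s (srs (etau_fps 1) (J0 p))))
    - cscale (h / 2) (J0 (J0 (twm s (srs (etau_fps 1) p - srs (etau_fps 2) p))))
    + cscale h (J0 (twm s (srs (etau_fps 1) p - srs (etau_fps 2) p)))"
proof (rule cf_eqI)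
  fix a b
  define x where "x = - (1/2) * wgt a b"
  have w: "wgt a b = - 2 * x" by (simp add: x_def field_simps)
  have twm: "bcoeff (twm t q) a b = bcoeff (t (srs (etau_fps x) q)) a b" if "linop t" for t q
    using cf_twist[OF that] by (simp add: x_def)
  show "bcoeff (twm (s \<circ> Jm) p) a b = bcoeff (twm s (Jm p) - cscale h (J0 (twm s (srs (etau_fps 1) (J0 p))))
    - cscale (h / 2) (J0 (J0 (twm s (srs (etau_fps 1) p - srs (etau_fps 2) p))))
    + cscale h (J0 (twm s (srs (etau_fps 1) p - srs (etau_fps 2) p)))) a b"
    unfolding cf_add cf_diff cf_scale cf_J0 w twm[OF s] twm[OF linop_comp[OF s linop_J(2)]] o_apply Jm_Et
    by (simp add: linops[OF s] linops[OF linop_S] Et_add S_mult S_comm[of "etau_fps x" "etau_fps 1"] S_comm[of "etau_fps x" "etau_fps 2"] algebra_simps)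
qed

subsection \<open>The element \<open>u\<close>\<close>

lemma u_Jp: "twu (Jp p) = Jp (twu (srs (etau_fps (- 1)) p))"
  using tw_Jp_left[OF linop_id, of p] tw_Jp_right[OF linop_id, of p]
  by (simp add: twist_u_def comp_def)

lemma u_T: "twu (hJp p) = hJp (twu (srs (etau_fps (- 1)) p))"
  by (simp add: hJp_def op_scale_def linops[OF linop_u] u_Jp)

lemma E_u: "srs (esig_fps (- 1)) (twu p) = twu (srs (etau_fps 1) p)"
proof -
  have "hJp (twu p) = twu (hJp (srs (etau_fps 1) p))"
    by (simp add: u_T S_mult[symmetric] Et_add[symmetric] S_1)
  then have "srs (esig_fps (- 1)) (twu p) = twu (p - cscale 2 (hJp (srs (etau_fps 1) p)))"
    by (simp add: E_m1 S_diff S_1 S_const_mult S_X linops[OF linop_u])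
  also have "p - cscale 2 (hJp (srs (etau_fps 1) p)) = srs (1 - fps_const 2 * (fps_X * etau_fps 1)) p"
    by (simp only: S_diff S_1 S_const_mult S_mult S_const S_X)
  also have "1 - fps_const 2 * (fps_X * etau_fps 1) = etau_fps 1"
    using X_Et[of 0] by simp
  finally show ?thesis .
qed

lemma E2_u: "srs (esig_fps (- 2)) (twu p) = twu (srs (etau_fps 2) p)"
proof -
  have "srs (esig_fps (- 1) * esig_fps (- 1)) (twu p) = twu (srs (etau_fps 1 * etau_fps 1) p)"
    by (simp add: S_mult E_u)
  then show ?thesis by (simp add: E_add[symmetric] Et_add[symmetric])
qed

lemma E1_u: "srs (esig_fps 1) (twu p) = twu (srs (etau_fps (- 1)) p)"
proof -
  have "srs (esig_fps (- 1)) (twu (srs (etau_fps (- 1)) p)) = twu p"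
    by (simp add: E_u S_mult[symmetric] Et_inv S_1)
  then show ?thesis by (metis E_inv S_mult S_1)
qed

end

lemma op_series_neg: "op_series F (hJp (- h)) p = op_series (fps_compose F (- fps_X)) (hJp h) p"
  using op_series_scaled[of F h] by (simp add: hJp_def)

lemma cf_u: "bcoeff (twist_u h p) a b = bcoeff (srs h (etau_fps (- (1/2) * wgt a b)) p) a b"
  by (simp add: twist_u_def cf_twist linop_id)

lemma cf_v: "bcoeff (twist_u (- h) p) a b = bcoeff (srs h (esig_fps (- (1/2) * wgt a b)) p) a b"
  unfolding cf_u op_series_neg Et_E
  by (subst fps_compose_assoc[symmetric]) (auto simp: fps_compose_uminus)

lemma v_T: "hJp h (twist_u (- h) p) = twist_u (- h) (srs h (fps_X * esig_fps 1) p)"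
proof (rule cf_eqI)
  fix a b
  define x where "x = - (1/2) * wgt a b"
  have "esig_fps x * (fps_X * esig_fps 1) = fps_X * esig_fps (x + 1)" by (simp add: E_add mult_ac)
  then have r: "bcoeff (twist_u (- h) (srs h (fps_X * esig_fps 1) p)) a b = bcoeff (hJp h (srs h (esig_fps (x + 1)) p)) a b"
    unfolding cf_v x_def[symmetric] by (simp only: S_mult[symmetric] S_X[symmetric])
  show "bcoeff (hJp h (twist_u (- h) p)) a b = bcoeff (twist_u (- h) (srs h (fps_X * esig_fps 1) p)) a b"
  proof (cases a)
    case (Suc a')
    have x: "- (1/2) * wgt a' (Suc b) = x + 1" by (simp add: x_def Suc field_simps)
    show ?thesis unfolding r unfolding Suc cf_T cf_v
      by (simp only: diff_Suc_1 x)
  next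
    case 0
    show ?thesis unfolding r unfolding 0 cf_T by simp
  qed
qed

lemma v_S:
  "srs h F (twist_u (- h) p) = twist_u (- h) (srs h (fps_compose F (fps_X * esig_fps 1)) p)"
proof -
  let ?Y = "srs h (fps_X * esig_fps 1)" and ?v = "twist_u (- h)"
  have pow: "(hJp h ^^ n) (?v p) = ?v ((?Y ^^ n) p)" for n
    by (induction n) (simp_all add: v_T)
  obtain N where *: "(hJp h ^^ N) p = 0" using T_nilpotent by meson
  have N: "(?Y ^^ N) p = 0"
    unfolding S_power using startsby_zero_power_prefix[of "fps_X * esig_fps 1 :: complex fps"]
    by (intro S_zero_high[OF *]) auto
  have N': "(hJp h ^^ N) (?v p) = 0" by (simp add: pow N linops[OF linop_u])
  have "srs h F (?v p) = ?v (op_series F ?Y p)"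
    by (simp add: op_series_eq[OF linop_T N'] op_series_eq[OF linop_S N] pow linops[OF linop_u])
  then show ?thesis by (simp add: S_compose)
qed

lemma tau_Y: "fps_compose tau_fps (fps_X * esig_fps 1) = - sigma_fps"
proof -
  define Y where "Y = fps_X * esig_fps 1"
  have Y0: "Y $ 0 = 0" by (simp add: Y_def)
  have Y: "fps_const 2 * Y = esig_fps 1 - 1" using X_E[of 0] by (simp add: Y_def)
  have e: "fps_compose (etau_fps (- 1)) Y = esig_fps 1"
    using Y Y0 by (simp add: Et_m1 fps_compose_add_distrib fps_compose_mult_distrib)
  have "fps_compose (etau_fps 1) Y * esig_fps 1 = fps_compose (etau_fps 1 * etau_fps (- 1)) Y"
    by (simp only: fps_compose_mult_distrib[OF Y0] e)
  then have e2: "fps_compose (etau_fps 1) Y * esig_fps 1 = 1" by (simp only: Et_inv fps_compose_1)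
  have "fps_compose (etau_fps 1) Y = fps_compose (etau_fps 1) Y * (esig_fps 1 * esig_fps (- 1))"
    by (simp only: E_inv mult_1_right)
  then have e1: "fps_compose (etau_fps 1) Y = esig_fps (- 1)"
    by (simp only: mult.assoc[symmetric] e2 mult_1_left)
  have "fps_deriv (fps_const 2 * Y) = fps_const 2 * esig_fps 2"
    unfolding Y by (simp add: E_deriv)
  then have d: "fps_const 2 * fps_deriv Y = fps_const 2 * esig_fps 2" by simp
  have "fps_deriv (fps_compose tau_fps Y) = - (esig_fps (- 1) * (fps_const 2 * fps_deriv Y))"
    using Y0 by (simp add: fps_compose_deriv tau_deriv fps_compose_uminus fps_compose_mult_distrib e1)
  also have "\<dots> = - (fps_const 2 * (esig_fps 2 * esig_fps (- 1)))"
    unfolding d by simp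
  also have "\<dots> = fps_deriv (- sigma_fps)" by (simp add: sigma_deriv E_add[symmetric])
  finally show ?thesis unfolding Y_def[symmetric] by (simp only: fps_deriv_eq_iff) simp
qed

lemma Et_Y: "fps_compose (etau_fps x) (fps_X * esig_fps 1) = esig_fps (- x)"
proof -
  have "fps_compose (etau_fps x) (fps_X * esig_fps 1) = fps_compose (fps_exp x) (- sigma_fps)"
    unfolding etau_fps_def by (subst fps_compose_assoc[symmetric]) (simp_all add: tau_Y)
  also have "\<dots> = fps_compose (fps_exp x) (fps_compose (- fps_X) sigma_fps)"
    by (simp add: fps_compose_uminus)
  also have "\<dots> = fps_compose (fps_compose (fps_exp x) (- fps_X)) sigma_fps"
    by (rule fps_compose_assoc) simp_all
  also have "\<dots> = esig_fps (- x)"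
    unfolding esig_fps_def by (simp only: fps_fps_exp_compose_minus)
  finally show ?thesis .
qed

lemma u_v: "twist_u h (twist_u (- h) p) = p"
proof (rule cf_eqI)
  fix a b
  define x where "x = - (1/2) * wgt a b"
  show "bcoeff (twist_u h (twist_u (- h) p)) a b = bcoeff p a b"
    unfolding cf_u[of h] v_S unfolding cf_v x_def[symmetric] Et_Y unfolding S_mult[symmetric] E_inv S_1 ..
qed

lemma bij_u: "bij (twist_u h)"
proof (rule o_bij)
  show "twist_u (- h) \<circ> twist_u h = id"
    using u_v[of "- h"] by (simp add: fun_eq_iff)
  show "twist_u h \<circ> twist_u (- h) = id"
    by (simp add: fun_eq_iff u_v)
qed

lemma inv_u: "twist_u h (inv (twist_u h) p) = p"
  by (rule surj_f_inv_f[OF bij_is_surj[OF bij_u]])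

subsection \<open>Explicit form of the adjoint action\<close>

lemma ad_twist_u:
  "ad h X t (twist_u h p) = twisted_coproduct h X (t \<circ> twist_u h) p"
  unfolding ad_def o_apply inv_f_f[OF bij_is_inj[OF bij_u]] ..

lemma ad_apply:
  assumes t: "linop t" and X: "linop X"
  obtains s where "linop s" "twist_exp h (- (1/2)) s = t \<circ> twist_u h"
    "\<And>p. ad h X t (twist_u h p) = twist_exp h (- (1/2)) (X \<circ> s) p - twist_exp h (- (1/2)) (s \<circ> X) p"
proof -
  have tu: "linop (t \<circ> twist_u h)" by (rule linop_comp[OF t linop_u])
  define s where "s = twist_exp h (1/2) (t \<circ> twist_u h)"
  have s: "linop s" unfolding s_def by (rule linop_twist[OF tu])
  have z: "- (1/2) + 1/2 = (0::complex)" by simp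
  have 1: "twist_exp h (- (1/2)) s = t \<circ> twist_u h"
    unfolding s_def twist_add[OF tu] z by (rule twist_0[OF tu])
  have "ad h X t (twist_u h p) = twist_exp h (- (1/2)) (X \<circ> s) p - twist_exp h (- (1/2)) (s \<circ> X) p" for p
    unfolding ad_twist_u twisted_coproduct_def o_apply s_def[symmetric] primitive_coproduct_def
        tw_diff[OF linop_comp[OF X s] linop_comp[OF s X]] by simp
  with s 1 show ?thesis using that by blast
qed

lemma u_surjE: obtains p where "q = twist_u h p"
  using inv_u[of h q] by metis

lemma ad_J0_explicit:
  assumes t: "linop t"
  shows "ad h J0 t = comm J0 t \<circ> exp_sigma h (- 1)"
proof
  fix q
  obtain p where q: "q = twist_u h p" by (rule u_surjE)
  obtain s where s: "linop s" and ts: "twist_exp h (- (1/2)) s = t \<circ> twist_u h"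
    and ad: "\<And>p. ad h J0 t (twist_u h p) = twist_exp h (- (1/2)) (J0 \<circ> s) p - twist_exp h (- (1/2)) (s \<circ> J0) p"
    using ad_apply[where h=h, OF t linop_J(3)] by metis
  have uJ0: "twist_u h (J0 p) = J0 (twist_u h (srs h (etau_fps 1) p))" for p
    using tw_J0_left[OF linop_id, of h p] tw_J0_right[OF linop_id, of h p]
    by (simp add: twist_u_def[symmetric] linops[OF linop_u] linops[OF linop_J(3)])
  show "ad h J0 t q = (comm J0 t \<circ> exp_sigma h (- 1)) q"
    unfolding q ad tw_J0_left[OF s] tw_J0_right[OF s] ts
    by (simp add: comm_def exp_sigma_S E_u uJ0 linops[OF t] linops[OF linop_u] linops[OF linop_J(3)])
qed

lemma ad_Jp_explicit:
  assumes t: "linop t"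
  shows "ad h Jp t = exp_sigma h (- 1) \<circ> comm (Jp \<circ> exp_sigma h 1) t"
proof
  fix q
  obtain p where q: "q = twist_u h p" by (rule u_surjE)
  obtain s where s: "linop s" and ts: "twist_exp h (- (1/2)) s = t \<circ> twist_u h"
    and ad: "\<And>p. ad h Jp t (twist_u h p) = twist_exp h (- (1/2)) (Jp \<circ> s) p - twist_exp h (- (1/2)) (s \<circ> Jp) p"
    using ad_apply[where h=h, OF t linop_J(1)] by metis
  define r where "r = srs h (esig_fps 1) q"
  have e1: "ad h Jp t q = Jp (t r) - t (Jp r)"
    unfolding q ad tw_Jp_left[OF s] tw_Jp_right[OF s] ts o_apply u_Jp by (simp add: r_def q E1_u)
  have qr: "q = r - cscale (2 * h) (Jp r)"
  proof -
    have "q = srs h (esig_fps (- 1)) r" by (simp add: r_def S_mult[symmetric] E_add[symmetric] S_1)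
    then show ?thesis
      by (simp add: E_m1 S_diff S_1 S_const_mult S_X) (simp add: hJp_def op_scale_def)
  qed
  have e2: "srs h (esig_fps (- 1)) (Jp (srs h (esig_fps 1) (t q))) = Jp (t q)"
    by (simp add: Jp_S S_mult[symmetric] E_add[symmetric] S_1)
  have e3: "srs h (esig_fps (- 1)) (t (Jp r)) = t (Jp r) - cscale (2 * h) (Jp (t (Jp r)))"
    by (simp add: E_m1 S_diff S_1 S_const_mult S_X) (simp add: hJp_def op_scale_def)
  have e4: "Jp (t q) = Jp (t r) - cscale (2 * h) (Jp (t (Jp r)))"
    unfolding qr by (simp add: linops[OF t] linops[OF linop_J(1)])
  have "(exp_sigma h (- 1) \<circ> comm (Jp \<circ> exp_sigma h 1) t) q = Jp (t q) - srs h (esig_fps (- 1)) (t (Jp r))"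
    by (simp add: comm_def exp_sigma_S linops(2)[OF linop_S] r_def[symmetric] e2)
  also have "\<dots> = Jp (t r) - t (Jp r)" unfolding e3 unfolding e4 by simp
  finally show "ad h Jp t q = (exp_sigma h (- 1) \<circ> comm (Jp \<circ> exp_sigma h 1) t) q"
    unfolding e1 by (rule sym)
qed

lemma ad_Jm_explicit:
  fixes h :: complex
  assumes t: "linop t"
  defines "A \<equiv> Jm + op_scale h J0 + op_scale (h / 2) (J0 \<circ> J0)"
  shows "ad h Jm t = (comm A t \<circ> exp_sigma h (- 1)) - op_scale h (comm J0 t \<circ> exp_sigma h (- 2))
    - op_scale (h / 2) (comm J0 (comm J0 t) \<circ> exp_sigma h (- 2))"
proof
  fix q
  obtain p where q: "q = twist_u h p" by (rule u_surjE)
  obtain s where s: "linop s" and ts: "twist_exp h (- (1/2)) s = t \<circ> twist_u h"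
    and ad: "\<And>p. ad h Jm t (twist_u h p) = twist_exp h (- (1/2)) (Jm \<circ> s) p - twist_exp h (- (1/2)) (s \<circ> Jm) p"
    using ad_apply[where h=h, OF t linop_J(2)] by metis
  let ?twu = "twist_u h"
  have uJ0: "?twu (J0 p) = J0 (?twu (srs h (etau_fps 1) p))" for p
    using tw_J0_left[OF linop_id, of h p] tw_J0_right[OF linop_id, of h p]
    by (simp add: twist_u_def[symmetric] linops[OF linop_u] linops[OF linop_J(3)])
  define r1 r2 where "r1 = ?twu (srs h (etau_fps 1) p)" and "r2 = ?twu (srs h (etau_fps 2) p)"
  have r: "exp_sigma h (- 1) q = r1" "exp_sigma h (- 2) q = r2"
    by (simp_all add: exp_sigma_S q E_u E2_u r1_def r2_def)
  have E1: "srs h (esig_fps (- 1)) r1 = r2"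
    by (simp add: r1_def r2_def E_u S_mult[symmetric] Et_add[symmetric])
  have uEJ0: "?twu (srs h (etau_fps 1) (J0 p)) = J0 r2 + cscale 2 (r1 - r2)"
  proof -
    have "?twu (srs h (etau_fps 1) (J0 p)) = srs h (esig_fps (- 1)) (J0 r1)"
      by (simp add: uJ0 r1_def flip: E_u)
    also have "\<dots> = J0 r2 + cscale 2 (r1 - r2)"
      using J0_E[where h=h and x="- 1" and p=r1] by (simp add: E1 S_1 algebra_simps bp.scale_right_diff_distrib)
    finally show ?thesis .
  qed
  have uJm: "?twu (Jm p) = Jm r1 + cscale h (J0 (J0 r2 + cscale 2 (r1 - r2)))
     + cscale (h / 2) (J0 (J0 (r1 - r2))) - cscale h (J0 (r1 - r2))"
    using tw_Jm_left[OF linop_id, of h p] tw_Jm_right[OF linop_id, of h p]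
    unfolding id_comp comp_id twist_u_def[symmetric] uEJ0 linops(2)[OF linop_u]
      r1_def[symmetric] r2_def[symmetric]
    by (simp add: algebra_simps)
  have ad': "ad h Jm t q = Jm (t r1) - t (?twu (Jm p)) + cscale h (J0 (t (J0 r2 + cscale 2 (r1 - r2))))
     + cscale (h / 2) (J0 (J0 (t (r1 - r2)))) - cscale h (J0 (t (r1 - r2)))"
    unfolding q ad tw_Jm_left[OF s] tw_Jm_right[OF s] ts o_apply uEJ0 linops(2)[OF linop_u]
      r1_def[symmetric] r2_def[symmetric]
    by simp
  show "ad h Jm t q = ((comm A t \<circ> exp_sigma h (- 1)) - op_scale h (comm J0 t \<circ> exp_sigma h (- 2))
    - op_scale (h / 2) (comm J0 (comm J0 t) \<circ> exp_sigma h (- 2))) q"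
    unfolding ad' uJm comm_def A_def
    by (rule cf_eqI) (simp add: r op_scale_def linops[OF t] linops[OF linop_J(3)] linops[OF linop_J(2)]
      cf_J0 cf_2 field_simps)
qed

unbundle no fps_syntax

end

theory Submission
  imports Defs
begin

text \<open>
  The generators are derivations of the polynomial ring, and on powers of \<open>exp \<sigma>\<close> their commutators
  are known from the differential equation of the series. Hence all commutators with operators
  \<open>\<Phi>\<^sub>j\<^sub>m exp (x \<sigma>)\<close> are combinations of operators of this kind, and in the explicit form of the
  adjoint action the terms with the wrong exponent cancel exactly for \<open>x = m\<close>.
  Evaluated at the polynomial 1, the tensor operators are multiples of distinct monomials, so they
  are independent; a nonzero stable subspace reaches the highest weight vector by raising and then
  every other basis vector by lowering.
\<close>

subsection \<open>The generators as derivations\<close>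

lemma cscale_mult_left: "cscale c p * q = cscale c (p * q)"
  and cscale_mult_right: "p * cscale c q = cscale c (p * q)"
  by (simp_all add: cscale_def)

lemma op_scale_apply: "op_scale c t p = cscale c (t p)"
  by (simp add: op_scale_def)

lemma d_xi_mult: "d_xi (p * q) = d_xi p * q + p * d_xi q"
  by (simp add: d_xi_def pderiv_mult add.commute mult.commute)

text \<open>\<open>d_eta\<close> differentiates each coefficient of \<open>xi\<close> separately, so
  the rule reduces to differentiating the finite sums of the Cauchy product.\<close>

lemma d_eta_mult: "d_eta (p * q) = d_eta p * q + p * d_eta q"
proof -
  have "pderiv (sum f A) = (\<Sum>x\<in>A. pderiv (f x))" for f :: "nat \<Rightarrow> complex poly" and A
    by (induction A rule: infinite_finite_induct) (simp_all add: pderiv_add)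
  then show ?thesis
    by (intro poly_eqI)
       (simp add: d_eta_def coeff_map_poly coeff_mult pderiv_mult sum.distrib add.commute
          mult.commute[of _ "pderiv _"])
qed

lemma Jp_mult: "Jp (p * q) = Jp p * q + p * Jp q"
  and Jm_mult: "Jm (p * q) = Jm p * q + p * Jm q"
  and J0_mult: "J0 (p * q) = J0 p * q + p * J0 q"
  by (simp_all add: Jp_def Jm_def J0_def d_xi_mult d_eta_mult algebra_simps)

subsection \<open>The polynomials \<open>\<Phi>\<^sub>j\<^sub>m\<close>\<close>

lemma bcoeff_monom: "bcoeff (xi ^ k * eta ^ l) a b = (if a = k \<and> b = l then 1 else 0)"
proof -
  have "bcoeff (eta ^ l) a b = (if a = 0 \<and> b = l then 1 else 0)" for a b
  proof (induction l arbitrary: b)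
    case 0
    show ?case by (auto simp: bcoeff_def coeff_1)
  next
    case (Suc l)
    then show ?case by (auto simp: cf_eta)
  qed
  then show ?thesis
  proof (induction k arbitrary: a)
    case (Suc k)
    then show ?case by (auto simp: cf_xi mult.assoc)
  qed simp
qed

text \<open>The truncated exponents \<open>l - 1\<close> and \<open>k - 1\<close> are harmless at 0,
  where the scalar factor vanishes.\<close>

lemma Jp_monom: "Jp (xi ^ k * eta ^ l) = cscale (of_nat l) (xi ^ Suc k * eta ^ (l - 1))"
  and Jm_monom: "Jm (xi ^ k * eta ^ l) = cscale (of_nat k) (xi ^ (k - 1) * eta ^ Suc l)"
  and J0_monom: "J0 (xi ^ k * eta ^ l) = cscale (of_nat k - of_nat l) (xi ^ k * eta ^ l)"
  by (rule cf_eqI; auto simp del: power_Suc simp: cf_Jp cf_Jm cf_J0 bcoeff_monom)+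

lemma spin_weightE:
  assumes "j \<in> spins" "m \<in> weights j"
  obtains k l :: nat where "j = (real k + real l) / 2" "m = (real k - real l) / 2"
proof -
  obtain n k where j: "j = real n / 2" and m: "m = - j + real k" and le: "- j + real k \<le> j"
    using assms unfolding spins_def weights_def by blast
  then have "k \<le> n" by simp
  then show ?thesis using that[of k "n - k"] j m by (simp add: of_nat_diff field_simps)
qed

lemma Phi_monom:
  assumes "j + m = real k" "j - m = real l"
  shows "Phi j m = cscale (complex_of_real (1 / sqrt (fact k * fact l))) (xi ^ k * eta ^ l)"
  by (simp add: Phi_def assms)

text \<open>Writing \<open>Suc k\<close> as the square of its root absorbs the factor from
  differentiating a monomial into the normalization of the neighbouring one. Raising and lowering
  both use it, with the two exponents exchanged.\<close>

lemma sqrt_fact: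
  "real (Suc k) / sqrt (fact (Suc k) * fact l) =
     sqrt (real (Suc k) * real (Suc l)) / sqrt (fact k * fact (Suc l))"
proof -
  have pos: "sqrt (fact k) > 0" "sqrt (fact l) > 0" "sqrt (real (Suc k)) > 0" "sqrt (real (Suc l)) > 0"
    by simp_all
  have "real (Suc k) = sqrt (real (Suc k)) * sqrt (real (Suc k))" by simp
  then show ?thesis
    using pos unfolding fact_Suc of_nat_mult of_nat_id real_sqrt_mult by (simp add: divide_simps)
qed

lemma Jp_Phi:
  assumes "j \<in> spins" "m \<in> weights j"
  shows "Jp (Phi j m) = cscale (complex_of_real (sqrt ((j - m) * (j + m + 1)))) (Phi j (m + 1))"
proof -
  obtain k l where kl: "j = (real k + real l) / 2" "m = (real k - real l) / 2"
    using spin_weightE[OF assms] .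
  then have s: "j + m = real k" "j - m = real l" by (simp_all add: field_simps)
  show ?thesis
  proof (cases l)
    \<comment> \<open>Here m = j, and both sides vanish whatever value \<open>Phi\<close> takes
      outside the weights.\<close>
    case 0
    then show ?thesis by (simp add: Phi_monom[OF s] linops[OF linop_J(1)] Jp_monom s del: power_0 mult_1_right)
  next
    case (Suc l')
    have s': "j + (m + 1) = real (Suc k)" "j - (m + 1) = real l'" using s Suc by simp_all
    have "complex_of_real (real l / sqrt (fact k * fact l)) =
        complex_of_real (sqrt (real l * real (Suc k)) / sqrt (fact (Suc k) * fact l'))"
      using sqrt_fact[of l' k] by (simp only: Suc mult.commute)
    moreover have "(j - m) * (j + m + 1) = real l * real (Suc k)" by (simp add: s)
    ultimately show ?thesis
      by (simp add: Phi_monom[OF s] Phi_monom[OF s'] linops[OF linop_J(1)] Jp_monom Suc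
          del: power_Suc fact_Suc)
  qed
qed

lemma Jm_Phi:
  assumes "j \<in> spins" "m \<in> weights j"
  shows "Jm (Phi j m) = cscale (complex_of_real (sqrt ((j + m) * (j - m + 1)))) (Phi j (m - 1))"
proof -
  obtain k l where kl: "j = (real k + real l) / 2" "m = (real k - real l) / 2"
    using spin_weightE[OF assms] .
  then have s: "j + m = real k" "j - m = real l" by (simp_all add: field_simps)
  show ?thesis
  proof (cases k)
    case 0
    then show ?thesis by (simp add: Phi_monom[OF s] linops[OF linop_J(2)] Jm_monom s del: power_0 mult_1_left)
  next
    case (Suc k')
    have s': "j + (m - 1) = real k'" "j - (m - 1) = real (Suc l)" using s Suc by simp_all
    have "complex_of_real (real k / sqrt (fact k * fact l)) =
        complex_of_real (sqrt (real k * real (Suc l)) / sqrt (fact k' * fact (Suc l)))"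
      using sqrt_fact[of k' l] by (simp only: Suc)
    then show ?thesis
      by (simp add: Phi_monom[OF s] Phi_monom[OF s'] linops[OF linop_J(2)] Jm_monom s Suc add.commute
          del: power_Suc fact_Suc)
  qed
qed

lemma J0_Phi:
  assumes "j \<in> spins" "m \<in> weights j"
  shows "J0 (Phi j m) = cscale (complex_of_real (2 * m)) (Phi j m)"
proof -
  obtain k l where kl: "j = (real k + real l) / 2" "m = (real k - real l) / 2"
    using spin_weightE[OF assms] .
  then have s: "j + m = real k" "j - m = real l" by (simp_all add: field_simps)
  have "complex_of_real (2 * m) = of_nat k - of_nat l" by (simp add: kl)
  then show ?thesis
    by (simp only: Phi_monom[OF s] linops[OF linop_J(3)] J0_monom bp.scale_left_commute)
qed

subsection \<open>Ladder relations\<close>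

context
  fixes h :: complex and j :: real
begin

abbreviation "E x \<equiv> op_series (esig_fps x) (hJp h)"

text \<open>The exponent \<open>x\<close> of \<open>exp (x \<sigma>)\<close> is kept independent of
  the weight, because commutators shift the two separately.\<close>

definition Phi_E :: "real \<Rightarrow> complex \<Rightarrow> operator" where
  "Phi_E m x p = Phi j m * E x p"

lemma Phi_tilde_E: "Phi_tilde h j m = Phi_E m (complex_of_real m)"
  by (rule ext) (simp add: Phi_tilde_def Phi_E_def exp_sigma_S)

lemma linop_Phi_E: "linop (Phi_E m x)"
  by (rule linopI) (simp_all add: Phi_E_def linops[OF linop_S] distrib_left cscale_mult_right)

lemma E_E: "E x (E y p) = E (x + y) p"
  by (simp add: S_mult E_add)

lemma Phi_E_E: "Phi_E m x (E y p) = Phi_E m (x + y) p"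
  by (simp add: Phi_E_def E_E)

text \<open>This is \<open>S_Jm\<close> for the series of \<open>exp (x \<sigma>)\<close>;
  \<open>E_deriv\<close> and \<open>X_E_deriv\<close> turn the second-derivative term into a
  difference of exponentials.\<close>

lemma Jm_E: "E x (Jm p) = Jm (E x p) + cscale (2 * h * x) (E (x + 1) (J0 p))
   + cscale (2 * h * x * (x + 1)) (E (x + 2) p - E (x + 1) p)"
proof -
  have "fps_X * fps_deriv (fps_deriv (esig_fps x)) =
      fps_const (2 * x) * (fps_X * fps_deriv (esig_fps (x + 1)))"
    by (simp add: E_deriv[of x])
  also have "\<dots> = fps_const (2 * x) * (fps_const (x + 1) * (esig_fps (x + 2) - esig_fps (x + 1)))"
    by (simp only: X_E_deriv) (simp add: add.assoc)
  also have "\<dots> = fps_const (2 * x * (x + 1)) * (esig_fps (x + 2) - esig_fps (x + 1))"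
    by (simp only: mult.assoc[symmetric] fps_const_mult)
  finally show ?thesis
    using S_Jm[where h=h and F="esig_fps x" and p=p]
    by (simp add: E_deriv S_const_mult S_diff mult.left_commute[of h] mult.assoc)
qed

section \<open>Commuting the generators past \<Phi> times a power of exp \<sigma>\<close>

context
  fixes m :: real
  assumes j: "j \<in> spins" and m: "m \<in> weights j"
begin

text \<open>At the unshifted exponent \<Phi> contributes 2m and \<open>J0_E\<close> contributes -2x.
  They cancel for x = m, so that the commutator then has only the shifted exponent.\<close>

lemma J0_Phi_E: "J0 (Phi_E m x p) = Phi_E m x (J0 p)
    + cscale (2 * of_real m - 2 * x) (Phi_E m x p) + cscale (2 * x) (Phi_E m (x + 1) p)"
  by (rule cf_eqI)
     (simp add: Phi_E_def J0_mult J0_Phi[OF j m] J0_E cscale_mult_left cscale_mult_right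
       ring_distribs bp.scale_right_diff_distrib)

text \<open>\<open>Jp\<close> commutes with \<open>exp (x \<sigma>)\<close>, so only \<Phi> is
  raised and the exponent lags behind the weight; the twisted action has to make up for
  this.\<close>

lemma Jp_Phi_E: "Jp (Phi_E m x p) = Phi_E m x (Jp p)
    + cscale (of_real (sqrt ((j - m) * (j + m + 1)))) (Phi_E (m + 1) x p)"
  by (rule cf_eqI)
     (simp add: Phi_E_def Jp_mult Jp_Phi[OF j m] Jp_S cscale_mult_left)

lemma Jm_Phi_E: "Jm (Phi_E m x p) = Phi_E m x (Jm p)
    + cscale (of_real (sqrt ((j + m) * (j - m + 1)))) (Phi_E (m - 1) x p)
    - cscale (2 * h * x) (Phi_E m (x + 1) (J0 p))
    - cscale (2 * h * x * (x + 1)) (Phi_E m (x + 2) p - Phi_E m (x + 1) p)"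
  by (rule cf_eqI)
     (simp add: Phi_E_def Jm_mult Jm_Phi[OF j m] Jm_E cscale_mult_left cscale_mult_right
       distrib_left right_diff_distrib bp.scale_right_diff_distrib)

section \<open>The adjoint action on the tensor operators\<close>

lemma comm_J0_Phi_tilde:
  "comm J0 (Phi_tilde h j m) = op_scale (2 * of_real m) (Phi_E m (of_real m + 1))"
  by (rule ext) (simp add: comm_def Phi_tilde_E J0_Phi_E op_scale_def)

lemma ad_J0_Phi_tilde:
  "ad h J0 (Phi_tilde h j m) = op_scale (of_real (2 * m)) (Phi_tilde h j m)"
proof -
  have "linop (Phi_tilde h j m)" by (simp add: Phi_tilde_E linop_Phi_E)
  \<comment> \<open>The factor \<open>exp (- \<sigma>)\<close> in \<open>ad_J0_explicit\<close>
    lowers the exponent m + 1 back to m.\<close>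
  then show ?thesis
    by (simp add: fun_eq_iff ad_J0_explicit comm_J0_Phi_tilde op_scale_def exp_sigma_S Phi_E_E)
       (simp add: Phi_tilde_E)
qed

lemma ad_Jp_Phi_tilde:
  "ad h Jp (Phi_tilde h j m) =
     op_scale (of_real (sqrt ((j - m) * (j + m + 1)))) (Phi_tilde h j (m + 1))"
proof
  fix p
  have E_m1: "E (- 1) q = q - cscale (2 * h) (Jp q)" for q
    by (simp add: E_m1 S_diff S_1 S_const_mult S_X) (simp add: hJp_def op_scale_def)
  \<comment> \<open>\<open>1 - 2 h J\<^sub>+ = exp (- \<sigma>)\<close> without division by \<open>h\<close>, which may be 0\<close>
  have X: "cscale (2 * h) (Phi_E k (x + 1) (Jp q)) = Phi_E k (x + 1) q - Phi_E k x q" for k x q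
  proof -
    have "cscale (2 * h) (Jp (E (x + 1) q)) = E (x + 1) q - E x q"
      using E_m1[of "E (x + 1) q"] by (simp add: E_E)
    then show ?thesis
      by (simp add: Phi_E_def cscale_mult_right[symmetric] Jp_S right_diff_distrib)
  qed
  have "ad h Jp (Phi_tilde h j m) p =
     Jp (Phi_E m (of_real m) p) - E (- 1) (Phi_E m (of_real m + 1) (Jp p))"
    by (simp add: ad_Jp_explicit[OF linop_Phi_E] comm_def Phi_tilde_E exp_sigma_S linops[OF linop_S]
      Jp_S E_E Phi_E_E S_1)
  \<comment> \<open>\<open>X\<close> turns each factor 2h \<open>Jp\<close> into a difference of
    exponents. The terms \<open>Phi_E m m (Jp p)\<close> and those with \<Phi> at weight m + 1 and
    exponent m cancel, leaving weight and exponent m + 1.\<close>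
  also have "\<dots> = op_scale (of_real (sqrt ((j - m) * (j + m + 1)))) (Phi_tilde h j (m + 1)) p"
    unfolding E_m1 Jp_Phi_E Phi_tilde_E op_scale_def
    by (simp only: bp.scale_right_distrib bp.scale_left_commute[of "2 * h"] X of_real_add of_real_1)
       (simp add: bp.scale_right_diff_distrib)
  finally show "ad h Jp (Phi_tilde h j m) p =
     op_scale (of_real (sqrt ((j - m) * (j + m + 1)))) (Phi_tilde h j (m + 1)) p" .
qed

lemma ad_Jm_Phi_tilde:
  "ad h Jm (Phi_tilde h j m) =
     op_scale (of_real (sqrt ((j + m) * (j - m + 1)))) (Phi_tilde h j (m - 1))"
proof -
  define A where "A = Jm + op_scale h J0 + op_scale (h / 2) (J0 \<circ> J0)"
  \<comment> \<open>The \<open>J0 \<circ> J0\<close> part of \<open>A\<close> cancels the terms of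
    \<open>Jm_Phi_E\<close> that contain \<open>J0 p\<close> or the exponent m + 2.\<close>
  have A: "comm A (Phi_tilde h j m) p =
      cscale (of_real (sqrt ((j + m) * (j - m + 1)))) (Phi_E (m - 1) (of_real m) p)
      + cscale (2 * h * of_real m * (of_real m + 1)) (Phi_E m (of_real m + 1) p)" for p
    by (rule cf_eqI)
       (simp add: comm_def A_def Phi_tilde_E Jm_Phi_E J0_Phi_E linops[OF linop_J(3)]
         linops[OF linop_Phi_E] op_scale_def cf_2 field_simps)
  have B: "comm J0 (op_scale (2 * of_real m) (Phi_E m (of_real m + 1))) p =
      cscale (4 * of_real m * (of_real m + 1)) (Phi_E m (of_real m + 2) p)
      - cscale (4 * of_real m) (Phi_E m (of_real m + 1) p)" for p
    by (rule cf_eqI)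
       (simp add: comm_def J0_Phi_E op_scale_apply linops[OF linop_J(3)] algebra_simps)
  have "linop (Phi_tilde h j m)" by (simp add: Phi_tilde_E linop_Phi_E)
  note ad = ad_Jm_explicit[OF this, where h=h, folded A_def]
  \<comment> \<open>After the shifts by \<open>exp (- \<sigma>)\<close> and
    \<open>exp (- 2 \<sigma>)\<close>, the terms of weight m, with exponents m and m - 1, cancel
    between \<open>A\<close>, the single and the double commutator. What remains has weight and
    exponent m - 1.\<close>
  show ?thesis
    unfolding ad comm_J0_Phi_tilde
    by (intro ext cf_eqI)
       (simp add: A B exp_sigma_S op_scale_apply Phi_E_E, simp add: Phi_tilde_E field_simps)
qed

end

end

subsection \<open>Irreducibility\<close>

text \<open>The irreducibility argument for a finite chain of basis vectors with nonzero raising and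
  lowering coefficients. Linearity of \<open>U\<close> is required on \<open>V\<close> only, since
  \<open>ad\<close> will be shown linear on linear operators only.\<close>

lemma (in vector_space) ladder_irreducible:
  fixes f :: "nat \<Rightarrow> 'b" and n :: nat and U D :: "'b \<Rightarrow> 'b"
  defines "V \<equiv> span (f ` {..n})"
  assumes ind: "independent (f ` {..n})" and inj: "inj_on f {..n}"
    and U_add: "\<And>s t. s \<in> V \<Longrightarrow> t \<in> V \<Longrightarrow> U (s + t) = U s + U t"
    and U_scale: "\<And>c t. t \<in> V \<Longrightarrow> U (c *s t) = c *s U t"
    and U: "\<And>k. k < n \<Longrightarrow> U (f k) = a k *s f (Suc k)" "\<And>k. k < n \<Longrightarrow> a k \<noteq> 0" "U (f n) = 0"
    and D: "\<And>k. k < n \<Longrightarrow> D (f (Suc k)) = b k *s f k" "\<And>k. k < n \<Longrightarrow> b k \<noteq> 0"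
    and W: "subspace W" "W \<subseteq> V" "W \<noteq> {0}" "\<And>t. t \<in> W \<Longrightarrow> U t \<in> W" "\<And>t. t \<in> W \<Longrightarrow> D t \<in> W"
  shows "W = V"
proof -
  \<comment> \<open>A descending filtration from \<open>V\<close> at \<open>k = 0\<close> to the
    zero space at \<open>k = Suc n\<close>; \<open>U\<close> moves each term into the next.\<close>
  let ?V = "\<lambda>k. span (f ` {k..n})"
  have V_sub: "?V k \<subseteq> V" for k unfolding V_def by (intro span_mono) auto
  have fV: "f k \<in> V" if "k \<le> n" for k unfolding V_def using that by (auto intro: span_base)
  have U_0: "U 0 = 0" using U_scale[of 0 0] by (simp add: V_def span_zero)
  have U_V: "U t \<in> ?V (Suc k)" if "t \<in> ?V k" for t k
  proof -
    have "subspace {t \<in> V. U t \<in> ?V (Suc k)}"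
      using subspace_span[of "f ` {..n}"] unfolding V_def[symmetric]
      by (auto simp: subspace_def U_0 U_add U_scale span_zero span_add span_scale)
    moreover have "U (f i) \<in> ?V (Suc k)" if "i \<in> {k..n}" for i
    proof (cases "i = n")
      case False
      then have "f (Suc i) \<in> ?V (Suc k)" using that by (intro span_base) auto
      then show ?thesis using False that by (simp add: U span_scale)
    qed (simp add: U span_zero)
    ultimately have "?V k \<subseteq> {t \<in> V. U t \<in> ?V (Suc k)}" 
      by (intro span_minimal) (auto simp: fV)
    with that show ?thesis by blast
  qed
  have f_notin: "f k \<notin> ?V (Suc k)" if "k \<le> n" for k
  proof
    assume "f k \<in> ?V (Suc k)"
    moreover have "f ` {Suc k..n} \<subseteq> f ` {..n} - {f k}"
      using that by (auto dest: inj_onD[OF inj])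
    ultimately have "f k \<in> span (f ` {..n} - {f k})" using span_mono by blast
    with ind that show False by (auto simp: dependent_def)
  qed
  \<comment> \<open>Raising pushes the lowest nonzero component upwards until only the top one is left.\<close>
  have top: "f n \<in> W" if "d \<le> n" "t \<in> W" "t \<in> ?V (n - d)" "t \<noteq> 0" for d t
    using that
  proof (induction d arbitrary: t)
    case 0
    then obtain c where "t = c *s f n" by (auto simp: span_singleton)
    with 0 have "f n = inverse c *s t" by auto
    then show ?case using subspace_scale[OF W(1) \<open>t \<in> W\<close>] by metis
  next
    case (Suc d)
    define k where "k = n - Suc d"
    have k: "k < n" "Suc k = n - d" using Suc.prems by (auto simp: k_def)
    then have "f ` {k..n} = insert (f k) (f ` {Suc k..n})"
      by (simp add: atLeastAtMost_insertL[symmetric] del: atLeastAtMost_insertL)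
    then obtain c where c: "t - c *s f k \<in> ?V (Suc k)"
      using Suc.prems(3) by (auto simp: k_def[symmetric] span_breakdown_eq)
    show ?case
    proof (cases "c = 0")
      case True
      then show ?thesis using Suc c k by auto
    next
      case False
      have "U t = U ((t - c *s f k) + c *s f k)" by simp
      also have "\<dots> = U (t - c *s f k) + (c * a k) *s f (Suc k)"
        using c k V_sub fV subspace_scale[OF subspace_span, of "f k" "f ` {..n}" c]
        by (subst U_add) (auto simp: U U_scale V_def)
      finally have Ut: "U t = U (t - c *s f k) + (c * a k) *s f (Suc k)" .
      \<comment> \<open>Otherwise the component along \<open>f (Suc k)\<close> would be cancelled by
        vectors further up the chain, against independence.\<close>
      have "U t \<noteq> 0"
      proof
        assume "U t = 0"
        then have "(c * a k) *s f (Suc k) = - U (t - c *s f k)"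
          by (simp add: Ut eq_neg_iff_add_eq_0 add.commute)
        then have "(c * a k) *s f (Suc k) \<in> ?V (Suc (Suc k))"
          using U_V[OF c] by (simp add: span_neg)
        then have "inverse (c * a k) *s ((c * a k) *s f (Suc k)) \<in> ?V (Suc (Suc k))"
          by (rule span_scale)
        then show False using f_notin[of "Suc k"] k U(2)[of k] False
          by (simp del: inverse_mult_distrib)
      qed
      moreover have "U t \<in> ?V (n - d)"
        using U_V[of t k] Suc.prems(3) k by (simp add: k_def)
      ultimately show ?thesis using Suc.IH[of "U t"] Suc.prems W(4) by simp
    qed
  qed
  obtain t where t: "t \<in> W" "t \<noteq> 0" using W(1,3) subspace_0 by blast
  have fn: "f n \<in> W" using top[of n t] t W(2) by (auto simp: V_def atLeast0AtMost)
  have "f k \<in> W" if "k \<le> n" for k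
    using that
  proof (induction k rule: inc_induct)
    case base
    show ?case by (rule fn)
  next
    case (step k)
    then have "inverse (b k) *s D (f (Suc k)) \<in> W"
      by (intro subspace_scale W)
    then show ?case using step.hyps D by simp
  qed
  then have "V \<subseteq> W" unfolding V_def using W(1) by (intro span_minimal) auto
  with W(2) show ?thesis by blast
qed

subsection \<open>Linearity of the adjoint action\<close>

lemma linop_add: "linop s \<Longrightarrow> linop t \<Longrightarrow> linop (s + t)"
  by (rule linopI) (simp_all add: linops bp.scale_right_distrib)

lemma linop_zero: "linop 0"
  by (rule linopI) simp_all

lemma twist_exp_add: "linop s \<Longrightarrow> linop t \<Longrightarrow> twist_exp h c (s + t) = twist_exp h c s + twist_exp h c t"
  by (rule ext, rule cf_eqI) (simp add: cf_twist linop_add)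

lemma twist_exp_scale: "linop t \<Longrightarrow> twist_exp h c (op_scale d t) = op_scale d (twist_exp h c t)"
  by (rule ext, rule cf_eqI) (simp add: op_scale_apply cf_twist linop_op_scale)

lemma linop_primitive: "linop X \<Longrightarrow> linop t \<Longrightarrow> linop (primitive_coproduct X t)"
  by (simp add: primitive_coproduct_def linop_minus linop_comp)

lemma primitive_add:
  "linop X \<Longrightarrow> primitive_coproduct X (s + t) = primitive_coproduct X s + primitive_coproduct X t"
  by (simp add: primitive_coproduct_def fun_eq_iff linops)

lemma primitive_scale:
  "linop X \<Longrightarrow> primitive_coproduct X (op_scale c t) = op_scale c (primitive_coproduct X t)"
  by (simp add: primitive_coproduct_def op_scale_def fun_eq_iff linops bp.scale_right_diff_distrib)

text \<open>Exhibits the inverse as an operator of the same kind, so that \<open>linop_u\<close>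
  also gives its linearity.\<close>

lemma inv_twist_u: "inv (twist_u h) = twist_u (- h)"
  using u_v by (metis bij_betw_def bij_u inv_f_f ext)

lemma linop_ad: "linop X \<Longrightarrow> linop t \<Longrightarrow> linop (ad h X t)"
  by (simp add: ad_def twisted_coproduct_def inv_twist_u linop_comp linop_u linop_twist linop_primitive)

lemma ad_add:
  assumes "linop X" "linop s" "linop t"
  shows "ad h X (s + t) = ad h X s + ad h X t"
proof -
  have "(s + t) \<circ> twist_u h = (s \<circ> twist_u h) + (t \<circ> twist_u h)" by (simp add: fun_eq_iff)
  then show ?thesis
    using assms
    by (simp add: ad_def twisted_coproduct_def twist_exp_add linop_comp linop_u linop_twist
        linop_primitive primitive_add) (simp add: fun_eq_iff)
qed

lemma ad_scale:
  assumes "linop X" "linop t"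
  shows "ad h X (op_scale c t) = op_scale c (ad h X t)"
proof -
  have "op_scale c t \<circ> twist_u h = op_scale c (t \<circ> twist_u h)" by (simp add: fun_eq_iff op_scale_def)
  then show ?thesis
    using assms
    by (simp add: ad_def twisted_coproduct_def twist_exp_scale linop_comp linop_u linop_twist
        linop_primitive primitive_scale) (simp add: fun_eq_iff op_scale_def)
qed

lemma ad_zero: "linop X \<Longrightarrow> ad h X 0 = 0"
  using ad_scale[OF _ linop_zero, of X h 0] by simp

subsection \<open>The module spanned by the tensor operators\<close>

text \<open>\<open>Jp\<close> kills 1, so only the constant term of the series survives. Evaluation
  at 1 thus strips the exponential from a tensor operator.\<close>

lemma exp_sigma_1: "exp_sigma h c 1 = 1"
proof -
  have "Jp 1 = 0" using Jp_monom[of 0 0] by simp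
  then have "(hJp h ^^ Suc 0) 1 = 0" by (simp add: hJp_def op_scale_def)
  then show ?thesis
    by (simp add: exp_sigma_S op_series_eq[OF linop_T \<open>(hJp h ^^ Suc 0) 1 = 0\<close>] esig_fps_def)
qed

text \<open>At 1 the operator with index \<open>i\<close> gives a nonzero multiple of the monomial
  with exponents \<open>i\<close> and \<open>n - i\<close>. These coefficients are therefore
  functionals dual to the family up to nonzero factors.\<close>

lemma bcoeff_Phi_tilde:
  assumes "k \<le> n" "i \<le> n"
  shows "bcoeff (Phi_tilde h (real n / 2) (real i - real n / 2) 1) k (n - k) = 0 \<longleftrightarrow> i \<noteq> k"
proof -
  have "real n / 2 + (real i - real n / 2) = real i"
    "real n / 2 - (real i - real n / 2) = real (n - i)"
    using assms by (simp_all add: of_nat_diff)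
  note * = Phi_monom[OF this]
  show ?thesis by (auto simp: Phi_tilde_def exp_sigma_1 * bcoeff_monom)
qed

lemma weights_spin: "weights (real n / 2) = (\<lambda>k. real k - real n / 2) ` {..n}"
  by (auto simp: weights_def)

lemma Phi_tilde_independent:
  fixes n :: nat and h :: complex
  defines "f \<equiv> \<lambda>k. Phi_tilde h (real n / 2) (real k - real n / 2)"
  shows "inj_on f {..n}" "ops.independent (f ` {..n})"
proof -
  \<comment> \<open>Removing the index \<open>k\<close> instead of the vector \<open>f k\<close>
    makes this strong enough to give injectivity as well as independence.\<close>
  have notin: "f k \<notin> ops.span (f ` ({..n} - {k}))" if "k \<le> n" for k
  proof
    assume "f k \<in> ops.span (f ` ({..n} - {k}))"
    moreover have "ops.span (f ` ({..n} - {k})) \<subseteq> {t. bcoeff (t 1) k (n - k) = 0}"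
    proof (rule ops.span_minimal)
      show "ops.subspace {t. bcoeff (t 1) k (n - k) = 0}"
        by (simp add: ops.subspace_def op_scale_apply)
    qed (use that in \<open>auto simp: f_def bcoeff_Phi_tilde\<close>)
    ultimately show False using that by (auto simp: f_def bcoeff_Phi_tilde)
  qed
  show "inj_on f {..n}"
  proof (rule inj_onI, rule ccontr)
    fix i k assume *: "i \<in> {..n}" "k \<in> {..n}" "f i = f k" "i \<noteq> k"
    then have "f i \<in> ops.span (f ` ({..n} - {k}))" by (intro ops.span_base imageI) auto
    with * notin[of k] show False by auto
  qed
  show "ops.independent (f ` {..n})"
    unfolding ops.dependent_def
  proof clarify
    fix k assume k: "k \<le> n" and "f k \<in> ops.span (f ` {..n} - {f k})"
    moreover have "f ` {..n} - {f k} \<subseteq> f ` ({..n} - {k})" by auto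
    ultimately show False using ops.span_mono notin[OF k] by blast
  qed
qed

section \<open>The span as an irreducible representation\<close>

context
  fixes h :: complex and j :: real
  assumes j: "j \<in> spins"
begin

definition "V \<equiv> ops.span (Phi_tilde h j ` weights j)"

lemma Phi_tilde_V: "m \<in> weights j \<Longrightarrow> Phi_tilde h j m \<in> V"
  unfolding V_def by (intro ops.span_base imageI)

lemma V_induct:
  assumes "t \<in> V" "ops.subspace S" "\<And>m. m \<in> weights j \<Longrightarrow> Phi_tilde h j m \<in> S"
  shows "t \<in> S"
  using ops.span_minimal[of "Phi_tilde h j ` weights j" S] assms unfolding V_def by blast

lemma V_linop:
  assumes "t \<in> V"
  shows "linop t"
proof -
  have "t \<in> {t. linop t}"
    using assms
    by (rule V_induct)
       (auto simp: ops.subspace_def linop_zero linop_add linop_op_scale Phi_tilde_E linop_Phi_E)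
  then show ?thesis by simp
qed

lemma linop_J_cases: "X \<in> {Jp, Jm, J0} \<Longrightarrow> linop X"
  using linop_J by blast

text \<open>The ladder stops at \<open>m = \<plusminus>j\<close> because the coefficient vanishes there.\<close>

lemma weights_succ:
  assumes "m \<in> weights j"
  shows "m + 1 \<in> weights j \<or> j - m = 0" "m - 1 \<in> weights j \<or> j + m = 0"
proof -
  obtain n k where n: "j = real n / 2" and k: "k \<le> n" "m = - j + real k"
    using j assms by (auto simp: spins_def weights_def)
  show "m + 1 \<in> weights j \<or> j - m = 0"
    using k by (cases "k = n") (auto simp: n weights_spin intro!: image_eqI[of _ _ "Suc k"])
  show "m - 1 \<in> weights j \<or> j + m = 0"
    using k by (cases k) (auto simp: n weights_spin)
qed

lemma weights_bound: "m \<in> weights j \<Longrightarrow> 0 \<le> j - m" "m \<in> weights j \<Longrightarrow> 0 \<le> j + m"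
  by (auto simp: weights_def)

lemmas ad_Phi_tilde = ad_Jp_Phi_tilde[OF j] ad_Jm_Phi_tilde[OF j] ad_J0_Phi_tilde[OF j]

lemma ad_V:
  assumes "t \<in> V" "X \<in> {Jp, Jm, J0}"
  shows "ad h X t \<in> V"
proof -
  have X: "linop X" using assms(2) by (rule linop_J_cases)
  have V: "ops.subspace V" by (simp add: V_def)
  \<comment> \<open>Linearity of \<open>t\<close> is carried along because \<open>ad_add\<close> and
    \<open>ad_scale\<close> demand it.\<close>
  have "t \<in> {t. linop t \<and> ad h X t \<in> V}"
    using assms(1)
  proof (rule V_induct)
    show "ops.subspace {t. linop t \<and> ad h X t \<in> V}"
      using V by (auto simp: ops.subspace_def linop_zero linop_add linop_op_scale ad_zero ad_add
          ad_scale X)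
    fix m assume m: "m \<in> weights j"
    have "op_scale (of_real (sqrt ((j - m) * (j + m + 1)))) (Phi_tilde h j (m + 1)) \<in> V"
    proof (cases "m + 1 \<in> weights j")
      case False
      then have "of_real (sqrt ((j - m) * (j + m + 1))) = (0::complex)" using weights_succ(1)[OF m] by auto
      then show ?thesis by (simp only: ops.scale_zero_left ops.subspace_0[OF V])
    qed (simp add: ops.subspace_scale[OF V] Phi_tilde_V)
    moreover have "op_scale (of_real (sqrt ((j + m) * (j - m + 1)))) (Phi_tilde h j (m - 1)) \<in> V"
    proof (cases "m - 1 \<in> weights j")
      case False
      then have "of_real (sqrt ((j + m) * (j - m + 1))) = (0::complex)" using weights_succ(2)[OF m] by auto
      then show ?thesis by (simp only: ops.scale_zero_left ops.subspace_0[OF V])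
    qed (simp add: ops.subspace_scale[OF V] Phi_tilde_V)
    ultimately have "ad h X (Phi_tilde h j m) \<in> V"
      using assms(2) ops.subspace_scale[OF V Phi_tilde_V[OF m]] m
      by (auto simp del: of_real_mult simp: ad_Phi_tilde)
    then show "Phi_tilde h j m \<in> {t. linop t \<and> ad h X t \<in> V}"
      using V_linop[OF Phi_tilde_V[OF m]] by simp
  qed
  then show ?thesis by simp
qed

text \<open>By linearity it suffices to check the basis, where the ladder relations reduce the
  claims to those for the classical spin-j matrices.\<close>

lemma ad_relations:
  assumes "t \<in> V"
  shows "ad h J0 (ad h Jp t) - ad h Jp (ad h J0 t) = op_scale 2 (ad h Jp t)"
    and "ad h J0 (ad h Jm t) - ad h Jm (ad h J0 t) = op_scale (- 2) (ad h Jm t)"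
    and "ad h Jp (ad h Jm t) - ad h Jm (ad h Jp t) = ad h J0 t"
proof -
  have rel: "P t = Q t"
    if "\<And>s t. linop s \<Longrightarrow> linop t \<Longrightarrow> P (s + t) = P s + P t" "\<And>s t. linop s \<Longrightarrow> linop t \<Longrightarrow> Q (s + t) = Q s + Q t"
      and "\<And>c t. linop t \<Longrightarrow> P (op_scale c t) = op_scale c (P t)" "\<And>c t. linop t \<Longrightarrow> Q (op_scale c t) = op_scale c (Q t)"
      and "\<And>m. m \<in> weights j \<Longrightarrow> P (Phi_tilde h j m) = Q (Phi_tilde h j m)"
    for P Q :: "operator \<Rightarrow> operator"
  proof -
    have "P 0 = Q 0" using that(3)[of 0 0] that(4)[of 0 0] linop_zero by simp
    then have "ops.subspace {t. linop t \<and> P t = Q t}"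
      using that(1-4) by (auto simp: ops.subspace_def linop_zero linop_add linop_op_scale)
    from V_induct[OF assms this] show ?thesis
      using that(5) V_linop Phi_tilde_V by auto
  qed
  define c d :: "real \<Rightarrow> complex"
    where "c m = of_real (sqrt ((j - m) * (j + m + 1)))"
      and "d m = of_real (sqrt ((j + m) * (j - m + 1)))" for m
  let ?T = "Phi_tilde h j"
  have ad_T: "ad h Jp (?T m) = op_scale (c m) (?T (m + 1))" "ad h Jm (?T m) = op_scale (d m) (?T (m - 1))"
    "ad h J0 (?T m) = op_scale (of_real (2 * m)) (?T m)" if "m \<in> weights j" for m
    using ad_Phi_tilde[OF that] by (simp_all add: c_def d_def)
  have lin_T: "linop (?T m)" for m by (simp add: Phi_tilde_E linop_Phi_E)
  have zero: "c m = 0 \<or> m + 1 \<in> weights j" "d m = 0 \<or> m - 1 \<in> weights j" if "m \<in> weights j" for m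
    using weights_succ[OF that] by (auto simp: c_def d_def)
  \<comment> \<open>Raising after lowering and lowering after raising meet the same radicand twice;
    it is nonnegative on weights, so the roots multiply to it.\<close>
  have dc: "d m * c (m - 1) = of_real ((j + m) * (j - m + 1))"
    and cd: "c m * d (m + 1) = of_real ((j - m) * (j + m + 1))" if "m \<in> weights j" for m
  proof -
    have "0 \<le> (j + m) * (j - m + 1)" "0 \<le> (j - m) * (j + m + 1)"
      using weights_bound[OF that] by simp_all
    then have "sqrt ((j + m) * (j - m + 1)) * sqrt ((j + m) * (j - m + 1)) = (j + m) * (j - m + 1)"
      "sqrt ((j - m) * (j + m + 1)) * sqrt ((j - m) * (j + m + 1)) = (j - m) * (j + m + 1)"
      by (simp_all only: real_sqrt_mult_self abs_of_nonneg)
    moreover have "(j - (m - 1)) * (j + (m - 1) + 1) = (j + m) * (j - m + 1)"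
      "(j + (m + 1)) * (j - (m + 1) + 1) = (j - m) * (j + m + 1)"
      by (simp_all add: algebra_simps)
    ultimately show "d m * c (m - 1) = of_real ((j + m) * (j - m + 1))"
      "c m * d (m + 1) = of_real ((j - m) * (j + m + 1))"
      by (simp_all only: c_def d_def of_real_mult[symmetric])
  qed
  \<comment> \<open>The prefactors \<open>c m\<close> and \<open>d m\<close> keep these valid at the
    ends of the ladder, where m + 1 or m - 1 may fail to be a weight.\<close>
  have J0c: "op_scale (c m) (ad h J0 (?T (m + 1))) = op_scale (c m * of_real (2 * (m + 1))) (?T (m + 1))"
    and J0d: "op_scale (d m) (ad h J0 (?T (m - 1))) = op_scale (d m * of_real (2 * (m - 1))) (?T (m - 1))"
    and Jmc: "op_scale (c m) (ad h Jm (?T (m + 1))) = op_scale (of_real ((j - m) * (j + m + 1))) (?T m)"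
    and Jpd: "op_scale (d m) (ad h Jp (?T (m - 1))) = op_scale (of_real ((j + m) * (j - m + 1))) (?T m)"
    if m: "m \<in> weights j" for m
    using zero[OF m] ad_T[of "m + 1"] ad_T[of "m - 1"]
    unfolding cd[OF m, symmetric] dc[OF m, symmetric] by auto
  note lin = ad_add ad_scale linop_ad linop_J add_diff_add ops.scale_right_distrib
    ops.scale_right_diff_distrib
  show "ad h J0 (ad h Jp t) - ad h Jp (ad h J0 t) = op_scale 2 (ad h Jp t)"
  proof (rule rel[where P="\<lambda>t. ad h J0 (ad h Jp t) - ad h Jp (ad h J0 t)"
        and Q="\<lambda>t. op_scale 2 (ad h Jp t)"])
    fix m assume m: "m \<in> weights j"
    show "ad h J0 (ad h Jp (?T m)) - ad h Jp (ad h J0 (?T m)) = op_scale 2 (ad h Jp (?T m))"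
      unfolding ad_T[OF m] ad_scale[OF linop_J(1) lin_T] ad_scale[OF linop_J(3) lin_T] J0c[OF m]
      by (intro ext cf_eqI) (simp add: op_scale_apply algebra_simps)
  qed (simp_all only: lin ops.scale_left_commute[of 2])
  show "ad h J0 (ad h Jm t) - ad h Jm (ad h J0 t) = op_scale (- 2) (ad h Jm t)"
  proof (rule rel[where P="\<lambda>t. ad h J0 (ad h Jm t) - ad h Jm (ad h J0 t)"
        and Q="\<lambda>t. op_scale (- 2) (ad h Jm t)"])
    fix m assume m: "m \<in> weights j"
    show "ad h J0 (ad h Jm (?T m)) - ad h Jm (ad h J0 (?T m)) = op_scale (- 2) (ad h Jm (?T m))"
      unfolding ad_T[OF m] ad_scale[OF linop_J(2) lin_T] ad_scale[OF linop_J(3) lin_T] J0d[OF m]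
      by (intro ext cf_eqI) (simp add: op_scale_apply algebra_simps)
  qed (simp_all only: lin ops.scale_left_commute[of "- 2"])
  show "ad h Jp (ad h Jm t) - ad h Jm (ad h Jp t) = ad h J0 t"
  proof (rule rel[where P="\<lambda>t. ad h Jp (ad h Jm t) - ad h Jm (ad h Jp t)"
        and Q="ad h J0"])
    fix m assume m: "m \<in> weights j"
    show "ad h Jp (ad h Jm (?T m)) - ad h Jm (ad h Jp (?T m)) = ad h J0 (?T m)"
      unfolding ad_T[OF m] ad_scale[OF linop_J(1) lin_T] ad_scale[OF linop_J(2) lin_T] Jmc[OF m] Jpd[OF m]
      \<comment> \<open>The scalar identity is (j + m)(j - m + 1) - (j - m)(j + m + 1) = 2m.\<close>
      by (intro ext cf_eqI) (simp add: op_scale_apply cf_2 algebra_simps)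
  qed (simp_all only: lin)
qed

lemma ad_irreducible_V: "ad_irreducible h V"
proof -
  obtain n where n: "j = real n / 2" using j by (auto simp: spins_def)
  \<comment> \<open>The index is k = j + m, running from 0 to n = 2j.\<close>
  define f where "f = (\<lambda>k. Phi_tilde h j (real k - j))"
  have f: "Phi_tilde h j ` weights j = f ` {..n}" by (auto simp: f_def n weights_spin)
  have w: "real k - j \<in> weights j" if "k \<le> n" for k using that by (auto simp: n weights_spin)
  have V: "V = ops.span (f ` {..n})" by (simp add: V_def f)
  have sub: "ops.subspace V" by (simp add: V_def)
  have ind: "inj_on f {..n}" "ops.independent (f ` {..n})"
    using Phi_tilde_independent[of h n] by (simp_all add: f_def n)
  have "ad_representation h V"
    unfolding ad_representation_def ad_stable_def
    by (intro conjI ballI allI sub ad_V ad_relations ad_add ad_scale linop_J_cases V_linop)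
  moreover have "f 0 \<noteq> 0"
    using ind(2) ops.dependent_zero[of "f ` {..n}"] imageI[of 0 "{..n}" f] by auto
  then have "V \<noteq> {0}" using Phi_tilde_V[OF w[of 0]] by (auto simp: f_def)
  moreover have "W = {0} \<or> W = V" if W: "ops.subspace W" "W \<subseteq> V" "ad_stable h W" for W
  proof (cases "W = {0}")
    case False
    have "W = ops.span (f ` {..n})"
    proof (rule ops.ladder_irreducible[OF ind(2,1), where U="ad h Jp" and D="ad h Jm"
          and a="\<lambda>k. of_real (sqrt ((j - (real k - j)) * (j + (real k - j) + 1)))"
          and b="\<lambda>k. of_real (sqrt ((j + (real (Suc k) - j)) * (j - (real (Suc k) - j) + 1)))"])
      show "ad h Jp (f n) = 0"
        unfolding f_def ad_Phi_tilde[OF w[OF order_refl]] by (simp add: n)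
      fix k assume k: "k < n"
      show "ad h Jp (f k) = op_scale (of_real (sqrt ((j - (real k - j)) * (j + (real k - j) + 1)))) (f (Suc k))"
        unfolding f_def using k by (subst ad_Phi_tilde(1)[OF w]) (simp_all add: algebra_simps)
      show "ad h Jm (f (Suc k)) =
          op_scale (of_real (sqrt ((j + (real (Suc k) - j)) * (j - (real (Suc k) - j) + 1)))) (f k)"
        unfolding f_def using k by (subst ad_Phi_tilde(2)[OF w]) (simp_all add: algebra_simps)
      \<comment> \<open>Both radicands equal (k + 1)(n - k), which is positive for
        \<open>k < n\<close>.\<close>
      show "of_real (sqrt ((j - (real k - j)) * (j + (real k - j) + 1))) \<noteq> (0 :: complex)"
        "of_real (sqrt ((j + (real (Suc k) - j)) * (j - (real (Suc k) - j) + 1))) \<noteq> (0 :: complex)"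
        using k by (simp_all add: n)
    next
      fix s t c assume "t \<in> ops.span (f ` {..n})"
      then have t: "linop t" by (intro V_linop) (simp add: V)
      show "ad h Jp (op_scale c t) = op_scale c (ad h Jp t)"
        by (rule ad_scale[OF linop_J(1) t])
      assume "s \<in> ops.span (f ` {..n})"
      then have s: "linop s" by (intro V_linop) (simp add: V)
      show "ad h Jp (s + t) = ad h Jp s + ad h Jp t"
        by (rule ad_add[OF linop_J(1) s t])
    next
      fix t assume "t \<in> W"
      then show "ad h Jp t \<in> W" "ad h Jm t \<in> W"
        using W(3) unfolding ad_stable_def by blast+
    qed (use False W V in blast)+
    then show ?thesis by (simp add: V)
  qed simp
  ultimately show ?thesis unfolding ad_irreducible_def by (intro conjI allI impI) simp_all
qed

lemma Phi_tilde_irreducible: "irreducible_tensor_operators h (weights j) (Phi_tilde h j)"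
proof -
  obtain n where n: "j = real n / 2" using j by (auto simp: spins_def)
  note * = Phi_tilde_independent[of h n]
  have "inj_on (Phi_tilde h j) (weights j)"
    using *(1) by (auto simp: n weights_spin inj_on_def)
  moreover have "ops.independent (Phi_tilde h j ` weights j)"
    using *(2) by (simp add: n weights_spin image_image)
  ultimately show ?thesis
    using ad_irreducible_V by (simp add: irreducible_tensor_operators_def V_def)
qed

end

theorem proposition7p1:
  fixes h :: complex and j :: real
  assumes "j \<in> spins"
  shows "irreducible_tensor_operators h (weights j) (Phi_tilde h j) \<and>
    (\<forall>m \<in> weights j.
       ad h Jp (Phi_tilde h j m) =
         op_scale (complex_of_real (sqrt ((j - m) * (j + m + 1)))) (Phi_tilde h j (m + 1)) \<and>
       ad h Jm (Phi_tilde h j m) =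
         op_scale (complex_of_real (sqrt ((j + m) * (j - m + 1)))) (Phi_tilde h j (m - 1)) \<and>
       ad h J0 (Phi_tilde h j m) =
         op_scale (complex_of_real (2 * m)) (Phi_tilde h j m))"
  using Phi_tilde_irreducible[OF assms] ad_Phi_tilde[OF assms] by (intro conjI ballI) simp_all

end
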